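(* Let $0\le\alpha<1$ and $0\le x_1<x_2\le1$, let $\mathcal{M}=\mathcal{M}_{\alpha,x_1,x_2}$ be the transformation of $[0,1)$ defined in the context and let $\mathcal{E}$ be its symmetric maximal invariant set. Assume $\mathcal{E}\ne\emptyset$. Then $Y(\alpha)\in\mathbb Q$. Moreover, if $Y(\alpha)=\frac NM$ is written as a simple fraction, then one of the following statements is valid: (i) $x_2<\frac1{2M}$ and $\alpha=\frac NM$. (ii) $x_1>1-\frac1{2M}$ and $\alpha=\big\langle\frac NM-(x_2-x_1)\big\rangle$. (iii) $M>1$ and there exist $0<\Delta<\frac1{M-1}$ and $|\delta|<\frac1{2M}-\frac{M-1}{2M}\Delta$ such that $$x_1=\frac{M-N}M-\frac NM\Delta+\delta,\quad x_2=\frac{M-N}M(1+\Delta)+\delta,\quad \alpha=\frac NM-\frac{M-N}M\Delta.$$ Conversely, if $\alpha,x_1,x_2$ satisfy one of (i), (ii), (iii) for some integers $0\le N<M$ such that $\frac NM$ is a simple fraction, then $\mathcal{E}\ne\emptyset$ and $Y(\alpha)=\frac NM$. Furthermore, $$\mathcal{E}=\bigcup_{k=0}^{M-1}I_k,$$ where, for $k=0,1,\dots,M-1$, $I_k=\frac kM+[x_2,\frac1M-x_2)$ in case (i), $I_k=\frac kM+[1-x_1,x_1-\frac{M-1}M)$ in case (ii), and $I_k=\frac kM(1+\Delta)+\big[|\delta|,\frac{1-(M-1)\Delta}M-|\delta|\big)$ in case (iii).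
   Context: $\langle x\rangle=x-\lfloor x\rfloor$ is the fractional part of $x$ and $\langle x\rangle^\ast=1-\langle1-x\rangle\in(0,1]$. A non-negative rational $x$ is written as a simple fraction $p/q$ when $p,q$ are co-prime positive integers with $x=p/q$ if $x\notin\mathbb Z$, and $p=x$, $q=1$ if $x\in\mathbb Z$. For $0\le\alpha<1$ and $0\le x_1<x_2\le 1$ put $U=[0,x_1)$, $\mathbf H=[x_1,x_2)$, $V=[x_2,1)$ and $\widetilde U=(0,x_1]$, $\widetilde{\mathbf H}=(x_1,x_2]$, $\widetilde V=(x_2,1]$. The map $\mathcal{M}=\mathcal{M}_{\alpha,x_1,x_2}:[0,1)\to[0,1)$ is $\mathcal{M}(t)=\langle t+\alpha+x_2-x_1\rangle$ for $t\in U$, $\mathcal{M}(t)=t$ for $t\in\mathbf H$, $\mathcal{M}(t)=\langle t+\alpha\rangle$ for $t\in V$. Its coherent map $\widetilde{\mathcal M}:(0,1]\to(0,1]$ is $\widetilde{\mathcal M}(t)=\langle t+\alpha+x_2-x_1\rangle^\ast$ for $t\in\widetilde U$, $\widetilde{\mathcal M}(t)=t$ for $t\in\widetilde{\mathbf H}$, $\widetilde{\mathcal M}(t)=\langle t+\alpha\rangle^\ast$ for $t\in\widetilde V$. The maximal invariant set $\mathcal{S}$ of $\mathcal{M}$ is the largest set $\mathcal{S}\subset[0,1)\setminus\mathbf H$ with $\mathcal{M}(\mathcal{S})=\mathcal{S}$; it is a finite union of left-closed right-open intervals. The symmetric maximal invariant set $\mathcal{E}$ of $\mathcal{M}$ is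 the largest set $\mathcal{E}\subset[0,1)\setminus\big(\mathbf H\cup(1-\widetilde{\mathbf H})\big)$ with $\mathcal{M}(\mathcal{E})=\mathcal{E}$ and $\widetilde{\mathcal M}(1-\mathcal{E})=1-\mathcal{E}$ (so $\mathcal{E}\subset\mathcal{S}$), where $1-E=\{1-t:t\in E\}$. If $\mathcal{S}\ne\emptyset$, the map $Y:[0,1)\to[0,1)$ is $Y(t)=\big\langle |\mathcal{S}\cap[0,t)|/|\mathcal{S}|\big\rangle$, where $|\cdot|$ of a set is Lebesgue measure. *)

theory Defs
  imports "HOL-Analysis.Analysis"
begin

definition frac_star :: "real \<Rightarrow> real" where
  "frac_star x = 1 - frac (1 - x)"

text \<open>The parameters range over \<open>0 \<le> \<alpha> < 1\<close> and \<open>0 \<le> x1 < x2 \<le> 1\<close>. The following map is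
  meant on \<open>[0,1)\<close> only and its coherent companion on \<open>(0,1]\<close> only, so that the last branch
  is \<open>t \<in> [x2,1)\<close>, respectively \<open>t \<in> (x2,1]\<close>; the values elsewhere are irrelevant.\<close>

definition hole_map :: "real \<Rightarrow> real \<Rightarrow> real \<Rightarrow> real \<Rightarrow> real" where
  "hole_map \<alpha> x1 x2 t =
     (if t \<in> {0..<x1} then frac (t + \<alpha> + x2 - x1)
      else if t \<in> {x1..<x2} then t
      else frac (t + \<alpha>))"

definition coherent_map :: "real \<Rightarrow> real \<Rightarrow> real \<Rightarrow> real \<Rightarrow> real" where
  "coherent_map \<alpha> x1 x2 t =
     (if t \<in> {0<..x1} then frac_star (t + \<alpha> + x2 - x1)
      else if t \<in> {x1<..x2} then t
      else frac_star (t + \<alpha>))"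

definition reflect :: "real set \<Rightarrow> real set" where
  "reflect E = (\<lambda>t. 1 - t) ` E"

definition invariant_off_hole :: "real \<Rightarrow> real \<Rightarrow> real \<Rightarrow> real set \<Rightarrow> bool" where
  "invariant_off_hole \<alpha> x1 x2 A \<longleftrightarrow>
     A \<subseteq> {0..<1} - {x1..<x2} \<and> hole_map \<alpha> x1 x2 ` A = A"

definition sym_invariant_off_hole :: "real \<Rightarrow> real \<Rightarrow> real \<Rightarrow> real set \<Rightarrow> bool" where
  "sym_invariant_off_hole \<alpha> x1 x2 A \<longleftrightarrow>
     A \<subseteq> {0..<1} - ({x1..<x2} \<union> reflect {x1<..x2}) \<and>
     hole_map \<alpha> x1 x2 ` A = A \<and>
     coherent_map \<alpha> x1 x2 ` reflect A = reflect A"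

text \<open>The largest sets with these properties are obtained as unions; the lemmas below confirm
  that each union has the property itself and hence is the greatest such set.\<close>

definition max_invariant :: "real \<Rightarrow> real \<Rightarrow> real \<Rightarrow> real set" where
  "max_invariant \<alpha> x1 x2 = \<Union>{A. invariant_off_hole \<alpha> x1 x2 A}"

definition sym_max_invariant :: "real \<Rightarrow> real \<Rightarrow> real \<Rightarrow> real set" where
  "sym_max_invariant \<alpha> x1 x2 = \<Union>{A. sym_invariant_off_hole \<alpha> x1 x2 A}"

lemma image_Union_fixed:
  assumes "\<And>A. A \<in> C \<Longrightarrow> f ` A = A"
  shows "f ` \<Union>C = \<Union>C"
  using assms by (simp add: image_Union)

lemma max_invariant_greatest:
  "invariant_off_hole \<alpha> x1 x2 (max_invariant \<alpha> x1 x2)"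
  "invariant_off_hole \<alpha> x1 x2 A \<Longrightarrow> A \<subseteq> max_invariant \<alpha> x1 x2"
proof -
  have "hole_map \<alpha> x1 x2 ` max_invariant \<alpha> x1 x2 = max_invariant \<alpha> x1 x2"
    unfolding max_invariant_def
    by (rule image_Union_fixed) (simp add: invariant_off_hole_def)
  moreover have "max_invariant \<alpha> x1 x2 \<subseteq> {0..<1} - {x1..<x2}"
    unfolding max_invariant_def invariant_off_hole_def by blast
  ultimately show "invariant_off_hole \<alpha> x1 x2 (max_invariant \<alpha> x1 x2)"
    by (simp add: invariant_off_hole_def)
  show "invariant_off_hole \<alpha> x1 x2 A \<Longrightarrow> A \<subseteq> max_invariant \<alpha> x1 x2"
    unfolding max_invariant_def by blast
qed

lemma sym_max_invariant_greatest:
  "sym_invariant_off_hole \<alpha> x1 x2 (sym_max_invariant \<alpha> x1 x2)"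
  "sym_invariant_off_hole \<alpha> x1 x2 A \<Longrightarrow> A \<subseteq> sym_max_invariant \<alpha> x1 x2"
proof -
  let ?C = "{A. sym_invariant_off_hole \<alpha> x1 x2 A}"
  have "hole_map \<alpha> x1 x2 ` \<Union>?C = \<Union>?C"
    by (rule image_Union_fixed) (simp add: sym_invariant_off_hole_def)
  moreover have "coherent_map \<alpha> x1 x2 ` reflect (\<Union>?C) = reflect (\<Union>?C)"
  proof -
    have r: "reflect (\<Union>?C) = \<Union>(reflect ` ?C)"
      by (auto simp: reflect_def)
    show ?thesis
      unfolding r
    proof (rule image_Union_fixed)
      fix B assume "B \<in> reflect ` ?C"
      then obtain A where "sym_invariant_off_hole \<alpha> x1 x2 A" "B = reflect A" by blast
      then show "coherent_map \<alpha> x1 x2 ` B = B"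
        by (simp add: sym_invariant_off_hole_def)
    qed
  qed
  moreover have "\<Union>?C \<subseteq> {0..<1} - ({x1..<x2} \<union> reflect {x1<..x2})"
    unfolding sym_invariant_off_hole_def by blast
  ultimately show "sym_invariant_off_hole \<alpha> x1 x2 (sym_max_invariant \<alpha> x1 x2)"
    by (simp add: sym_invariant_off_hole_def sym_max_invariant_def)
  show "sym_invariant_off_hole \<alpha> x1 x2 A \<Longrightarrow> A \<subseteq> sym_max_invariant \<alpha> x1 x2"
    unfolding sym_max_invariant_def by blast
qed

text \<open>Only meaningful when \<open>max_invariant \<alpha> x1 x2 \<noteq> {}\<close>; that set is then a finite union of
  left-closed right-open intervals, hence measurable and of positive length.\<close>

definition Y_map :: "real \<Rightarrow> real \<Rightarrow> real \<Rightarrow> real \<Rightarrow> real" where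
  "Y_map \<alpha> x1 x2 t =
     frac (measure lebesgue (max_invariant \<alpha> x1 x2 \<inter> {0..<t})
           / measure lebesgue (max_invariant \<alpha> x1 x2))"

definition simple_fraction :: "real \<Rightarrow> nat \<Rightarrow> nat \<Rightarrow> bool" where
  "simple_fraction x p q \<longleftrightarrow>
     (if x \<in> \<int> then real p = x \<and> q = 1
      else 0 < p \<and> 0 < q \<and> coprime p q \<and> x = real p / real q)"

definition case_i :: "nat \<Rightarrow> nat \<Rightarrow> real \<Rightarrow> real \<Rightarrow> real \<Rightarrow> bool" where
  "case_i N M \<alpha> x1 x2 \<longleftrightarrow> x2 < 1 / (2 * real M) \<and> \<alpha> = real N / real M"

definition case_ii :: "nat \<Rightarrow> nat \<Rightarrow> real \<Rightarrow> real \<Rightarrow> real \<Rightarrow> bool" where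
  "case_ii N M \<alpha> x1 x2 \<longleftrightarrow>
     x1 > 1 - 1 / (2 * real M) \<and> \<alpha> = frac (real N / real M - (x2 - x1))"

definition case_iii :: "nat \<Rightarrow> nat \<Rightarrow> real \<Rightarrow> real \<Rightarrow> real \<Rightarrow> real \<Rightarrow> real \<Rightarrow> bool" where
  "case_iii N M \<Delta> \<delta> \<alpha> x1 x2 \<longleftrightarrow>
     M > 1 \<and> 0 < \<Delta> \<and> \<Delta> < 1 / (real M - 1) \<and>
     \<bar>\<delta>\<bar> < 1 / (2 * real M) - (real M - 1) / (2 * real M) * \<Delta> \<and>
     x1 = (real M - real N) / real M - real N / real M * \<Delta> + \<delta> \<and>
     x2 = (real M - real N) / real M * (1 + \<Delta>) + \<delta> \<and>
     \<alpha> = real N / real M - (real M - real N) / real M * \<Delta>"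

end

(* Write f for the map with the hole, h = x2 - x1, and T(t) = 1 - g(1 - t) with g the coherent map.
   On an invariant set E of the required kind, T is the inverse of f: otherwise T o f would translate
   some point of E by h or by -h and, since a step of length h cannot cross a hole of length h,
   would go on doing so forever. If E meets both sides of the hole, it follows that f acts on E as
   the rotation by alpha + h of a circle of length 1 + h. As E misses an interval, the rotation angle is
   rational, equal to (N/M)(1 + h), so E is invariant under translation by (1 + h)/M, and comparing E
   with the hole and its mirror image gives case (iii) and the form of E. If E lies on one side of
   the hole, the same argument on the circle of length 1 gives cases (i) and (ii).

   As for Y(alpha), f preserves Lebesgue measure and the cyclic order on the maximal invariant set S,
   so each step advances |S cap [0,t)| by |S cap [0,alpha)| modulo |S|. Summing over a finite invariant
   set C gives |S cap [0,alpha)| / |S| = alpha + h * |C cap [0,x1)| / |C|. *)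

theory Submission
  imports Defs "HOL-Number_Theory.Cong"
begin

subsection \<open>Sets invariant under a rotation of the circle of length \<open>c\<close>\<close>

lemma frac_eq_add_int:
  fixes x y :: real
  assumes "x = y + of_int k" "0 \<le> y" "y < 1"
  shows "frac x = y"
  using assms by (simp add: frac_unique_iff)

text \<open>Here \<open>c * frac (y / c)\<close> is the representative of \<open>y\<close> modulo
  \<open>c\<close> in \<open>[0, c)\<close>, so \<open>closed\<close> says that the rotation by
  \<open>\<beta>\<close> maps \<open>X\<close> into itself.\<close>

lemma rotation_iterate:
  fixes c :: real
  assumes c: "c > 0" and X: "X \<subseteq> {0..<c}"
    and closed: "\<And>y. y \<in> X \<Longrightarrow> c * frac ((y + \<beta>) / c) \<in> X"
    and t: "t \<in> X"
  shows "c * frac ((t + real n * \<beta>) / c) \<in> X"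
proof (induction n)
  case 0
  have "frac (t / c) = t / c"
    using X t c by (intro frac_eq_add_int[where k = 0]) auto
  then show ?case using t c by simp
next
  case (Suc n)
  have "frac ((c * frac ((t + real n * \<beta>) / c) + \<beta>) / c) = frac ((t + real (Suc n) * \<beta>) / c)"
  proof -
    have "(t + real (Suc n) * \<beta>) / c =
        (c * frac ((t + real n * \<beta>) / c) + \<beta>) / c + of_int \<lfloor>(t + real n * \<beta>) / c\<rfloor>"
      using c by (simp add: frac_def field_simps)
    then show ?thesis by simp
  qed
  then show ?case using closed[OF Suc.IH] by simp
qed

text \<open>By Kronecker's theorem the forward orbit of a point under an irrational rotation is
  dense, so it would enter the gap \<open>[a, b)\<close>.\<close>

lemma rotation_rational:
  fixes c :: real
  assumes c: "c > 0" and X: "X \<subseteq> {0..<c}" "X \<noteq> {}"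
    and closed: "\<And>y. y \<in> X \<Longrightarrow> c * frac ((y + \<beta>) / c) \<in> X"
    and ab: "0 \<le> a" "a < b" "b \<le> c" "X \<inter> {a..<b} = {}"
  shows "\<beta> / c \<in> \<rat>"
proof (rule ccontr)
  assume irr: "\<beta> / c \<notin> \<rat>"
  obtain t where t: "t \<in> X" using X by blast
  \<comment> \<open>Midpoint and half-width of the gap on the circle rescaled to length 1.
    Kronecker's theorem is aimed at the rotation by \<open>m - t / c\<close>, which carries
    \<open>t\<close> to the midpoint.\<close>
  define m where "m = (a + b) / (2 * c)"
  define e where "e = (b - a) / (2 * c)"
  have e: "e > 0" using ab c by (simp add: e_def)
  obtain k where k: "\<bar>frac (real k * (\<beta> / c)) - frac (m - t / c)\<bar> < e"
    using Kronecker_approx_1_explicit[OF irr _ _ e, of "frac (m - t / c)"]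
    by (metis frac_ge_0 frac_lt_1 less_le)
  define d where "d = frac (real k * (\<beta> / c)) - frac (m - t / c)"
  have me: "m - e = a / c" "m + e = b / c"
    using c by (simp_all add: m_def e_def field_simps)
  have d: "a / c < m + d" "m + d < b / c"
    using k by (simp_all add: d_def flip: me)
  have "b / c \<le> 1" "0 \<le> a / c" using ab c by simp_all
  moreover have eq: "(t + real k * \<beta>) / c =
      (m + d) + of_int (\<lfloor>real k * (\<beta> / c)\<rfloor> - \<lfloor>m - t / c\<rfloor>)"
    using c by (simp add: d_def frac_def add_divide_distrib)
  ultimately have "frac ((t + real k * \<beta>) / c) = m + d"
    using d by (intro frac_eq_add_int[OF eq]) auto
  with rotation_iterate[OF c X(1) closed t, of k] have "c * (m + d) \<in> X" by simp
  moreover have "a < c * (m + d)" "c * (m + d) < b"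
    using d c by (simp_all add: field_simps)
  ultimately show False using ab by auto
qed

text \<open>For an angle of \<open>N / M\<close> turns in lowest terms, \<open>N\<close> generates
  the residues modulo \<open>M\<close>, so forward iteration from \<open>t\<close> visits its whole
  coset of spacing \<open>c / M\<close>. The offset of that coset is \<open>r\<close>, and
  \<open>k0\<close> is the index of \<open>t\<close> in it.\<close>

lemma rotation_cosets:
  fixes c :: real
  assumes c: "c > 0" and X: "X \<subseteq> {0..<c}"
    and closed: "\<And>y. y \<in> X \<Longrightarrow> c * frac ((y + \<beta>) / c) \<in> X"
    and M: "M > 0" "coprime N M" and \<beta>: "\<beta> / c = real N / real M"
    and t: "t \<in> X"
  obtains r k0 where "0 \<le> r" "r < c / real M" "k0 < M" "t = r + real k0 * (c / real M)"
    "\<And>k. k < M \<Longrightarrow> r + real k * (c / real M) \<in> X"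
proof -
  define P where "P = c / real M"
  have P: "P > 0" "real M * P = c" "\<beta> = real N * P"
    using c M \<beta> by (simp_all add: P_def field_simps)
  have t01: "0 \<le> t" "t < c" using X t by auto
  define k0 where "k0 = nat \<lfloor>t / P\<rfloor>"
  define r where "r = t - real k0 * P"
  have k0: "real k0 = of_int \<lfloor>t / P\<rfloor>"
    using t01 P by (simp add: k0_def)
  have "real k0 \<le> t / P" "t / P < real k0 + 1" unfolding k0 by linarith+
  then have r: "0 \<le> r" "r < P"
    using P by (simp_all add: r_def field_simps)
  have "real k0 * P < real M * P" using r t01 P by (simp add: r_def)
  then have k0M: "k0 < M" by (simp only: mult_less_cancel_right_pos[OF P(1)] of_nat_less_iff)
  obtain x where x: "[N * x = 1] (mod M)"
    using cong_solve_coprime_nat[OF M(2)] by auto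
  have "r + real k * P \<in> X" if "k < M" for k
  proof -
    \<comment> \<open>As \<open>x\<close> inverts \<open>N\<close> modulo \<open>M\<close>,
      \<open>n\<close> rotations move the index from \<open>k0\<close> to \<open>k\<close>; the
      summand \<open>M\<close> keeps the subtraction from truncating. The quotient \<open>l\<close>
      below counts the full turns.\<close>
    define n where "n = x * (k + M - k0)"
    have "[k0 + n * N = k0 + 1 * (k + M - k0)] (mod M)"
      unfolding n_def using x
      by (intro cong_add cong_refl) (metis cong_scalar_right mult.assoc mult.commute)
    moreover have "k0 + 1 * (k + M - k0) = k + M" using k0M by simp
    ultimately have "[k0 + n * N = k] (mod M)" by (simp add: cong_def)
    then have md: "(k0 + n * N) mod M = k" using that by (simp add: cong_def)
    define l where "l = (k0 + n * N) div M"
    have "k0 + n * N = M * l + k"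
      unfolding l_def using md mult_div_mod_eq[of M "k0 + n * N"] by metis
    then have "real k0 + real n * real N = real M * real l + real k"
      by (metis of_nat_add of_nat_mult)
    moreover have "t + real n * \<beta> = r + (real k0 + real n * real N) * P"
      by (simp add: r_def P algebra_simps)
    ultimately have "t + real n * \<beta> = (r + real k * P) + real l * c"
      by (simp add: algebra_simps flip: P(2))
    then have eq: "(t + real n * \<beta>) / c = (r + real k * P) / c + of_int (int l)"
      using c by (simp add: field_simps)
    have "real k + 1 \<le> real M" using that by simp
    then have "(real k + 1) * P \<le> real M * P" using P(1) by (intro mult_right_mono) auto
    then have "(real k + 1) * P \<le> c" unfolding P(2) .
    then have "r + real k * P < c" using r by (simp add: algebra_simps)
    moreover have "0 \<le> r + real k * P" using r P by simp
    ultimately have "frac ((t + real n * \<beta>) / c) = (r + real k * P) / c"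
      using c by (intro frac_eq_add_int[OF eq]) auto
    with rotation_iterate[OF c X closed t, of n] c show ?thesis by simp
  qed
  moreover have "t = r + real k0 * P" by (simp add: r_def)
  ultimately show ?thesis using that[of r k0] r k0M unfolding P_def by blast
qed

subsection \<open>Simple fractions\<close>

lemma simple_fraction_iff:
  assumes "N < M"
  shows "simple_fraction (real N / real M) N M \<longleftrightarrow> coprime N M"
proof (cases "N = 0")
  \<comment> \<open>For \<open>N = 0\<close> both sides amount to \<open>M = 1\<close>.\<close>
  case True
  then show ?thesis by (auto simp: simple_fraction_def)
next
  case False
  have "real N / real M \<notin> \<int>"
  proof
    assume "real N / real M \<in> \<int>"
    then obtain k :: int where "real N / real M = of_int k" by (auto elim: Ints_cases)
    moreover have "0 < real N / real M" "real N / real M < 1" using False assms by simp_all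
    ultimately show False by simp
  qed
  then show ?thesis using False assms by (simp add: simple_fraction_def)
qed

lemma coprime_fraction_unique:
  assumes "coprime (N::nat) M" "coprime N' M'" "M > 0" "M' > 0"
    "real N / real M = real N' / real M'"
  shows "N = N' \<and> M = M'"
proof -
  have "real N * real M' = real N' * real M" using assms by (simp add: field_simps)
  then have "real (N * M') = real (N' * M)" by simp
  then have "N * M' = N' * M" by (simp only: of_nat_eq_iff)
  then show ?thesis
    using coprime_crossproduct_nat[of N M N' M'] assms by auto
qed

lemma simple_fraction_unique:
  assumes "simple_fraction (real N / real M) N' M'" "N < M" "coprime N M"
  shows "N' = N \<and> M' = M"
proof -
  have "coprime N' M' \<and> M' > 0 \<and> real N / real M = real N' / real M'"
    using assms(1) by (auto simp: simple_fraction_def split: if_splits)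
  then show ?thesis using coprime_fraction_unique[of N M N' M'] assms by auto
qed

lemma unit_fraction_coprime:
  fixes x :: real
  assumes "x \<in> \<rat>" "0 \<le> x" "x < 1"
  obtains N M :: nat where "coprime N M" "N < M" "x = real N / real M"
proof -
  obtain N M :: nat where NM: "M \<noteq> 0" "\<bar>x\<bar> = real N / real M" "coprime N M"
    using Rats_abs_nat_div_natE[OF assms(1)] .
  moreover from this have "real N < real M" using assms by (simp add: divide_less_eq)
  then have "N < M" by simp
  ultimately show ?thesis using that assms by simp
qed

subsection \<open>The structure of symmetric invariant sets\<close>

locale hole =
  fixes \<alpha> x1 x2 :: real
  assumes \<alpha>: "0 \<le> \<alpha>" "\<alpha> < 1" and x: "0 \<le> x1" "x1 < x2" "x2 \<le> 1"
begin

abbreviation h :: real where "h \<equiv> x2 - x1"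

abbreviation f :: "real \<Rightarrow> real" where "f \<equiv> hole_map \<alpha> x1 x2"

lemma f_left: "0 \<le> t \<Longrightarrow> t < x1 \<Longrightarrow> f t = frac (t + \<alpha> + h)"
  by (simp add: hole_map_def algebra_simps)

lemma f_right: "x2 \<le> t \<Longrightarrow> f t = frac (t + \<alpha>)"
  using x by (simp add: hole_map_def)

end

locale sym_hole = hole +
  fixes E :: "real set"
  assumes E: "sym_invariant_off_hole \<alpha> x1 x2 E"
begin

lemma E_range: "t \<in> E \<Longrightarrow> 0 \<le> t" "t \<in> E \<Longrightarrow> t < 1"
  using E by (auto simp: sym_invariant_off_hole_def)

lemma E_hole: "t \<in> E \<Longrightarrow> t < x1 \<or> x2 \<le> t"
  using E by (fastforce simp: sym_invariant_off_hole_def)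

lemma E_reflected_hole:
  assumes "t \<in> E" shows "t < 1 - x2 \<or> 1 - x1 \<le> t"
proof (rule ccontr)
  assume "\<not> ?thesis"
  then have "1 - t \<in> {x1<..x2}" by auto
  then have "1 - (1 - t) \<in> reflect {x1<..x2}" unfolding reflect_def by (rule imageI)
  then show False using assms E by (auto simp: sym_invariant_off_hole_def)
qed

lemma f_in_E: "t \<in> E \<Longrightarrow> f t \<in> E"
  using E by (auto simp: sym_invariant_off_hole_def)

lemma f_onto_E: "s \<in> E \<Longrightarrow> \<exists>t\<in>E. f t = s"
  using E unfolding sym_invariant_off_hole_def by (metis imageE)

lemma reflected_map_in_E:
  assumes "t \<in> E" shows "1 - coherent_map \<alpha> x1 x2 (1 - t) \<in> E"
proof -
  have "coherent_map \<alpha> x1 x2 (1 - t) \<in> reflect E"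
    using E assms by (auto simp: sym_invariant_off_hole_def reflect_def)
  then show ?thesis by (auto simp: reflect_def)
qed

text \<open>The substitution \<open>1 - t\<close> turns \<open>frac_star\<close> into
  \<open>frac\<close>: the reflected coherent map subtracts \<open>\<alpha> + h\<close> after the
  reflected hole and \<open>\<alpha>\<close> before it. It therefore undoes \<open>f\<close> at a
  point as soon as \<open>f\<close> sends the left of the hole past the reflected hole, or the right
  of the hole before it.\<close>

lemma back_right: "t \<in> E \<Longrightarrow> 1 - x1 \<le> t \<Longrightarrow> frac (t - \<alpha> - h) \<in> E"
  using reflected_map_in_E[of t] E_range[of t]
  by (simp add: coherent_map_def frac_star_def algebra_simps)

lemma back_left: "t \<in> E \<Longrightarrow> t < 1 - x2 \<Longrightarrow> frac (t - \<alpha>) \<in> E"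
  using reflected_map_in_E[of t] E_range[of t] x
  by (simp add: coherent_map_def frac_star_def algebra_simps)

text \<open>If \<open>f\<close> followed by the reflected coherent map moved some point, it would move it by
  \<open>\<plusminus>h\<close> and the same again forever, because a step of length \<open>h\<close> cannot jump over a hole of
  length \<open>h\<close>.\<close>

lemma f_left_lands_right:
  assumes "t \<in> E" "t < x1"
  shows "1 - x1 \<le> f t"
proof (rule ccontr)
  assume contr: "\<not> ?thesis"
  have step: "t + h \<in> E \<and> t + h < x1 \<and> f (t + h) < 1 - x1"
    if t: "t \<in> E" "t < x1" "f t < 1 - x1" for t
  proof -
    have r: "0 \<le> t" "t < 1" using E_range[OF t(1)] by auto
    have f_coh: "f t = frac (t + \<alpha> + h)" using f_left r t by simp
    have fE: "f t \<in> E" "0 \<le> f t" using f_in_E[OF t(1)] E_range by auto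
    have lt: "f t < 1 - x2" using E_reflected_hole[OF fE(1)] t by auto
    \<comment> \<open>Here \<open>f\<close> has added \<open>\<alpha> + h\<close> but the way back
      subtracts only \<open>\<alpha>\<close>, so the round trip ends at
      \<open>t + h\<close>.\<close>
    have eq: "f t - \<alpha> = (t + h) + of_int (- \<lfloor>t + \<alpha> + h\<rfloor>)" by (simp add: f_coh frac_def)
    then have "frac (f t - \<alpha>) = t + h" using r t x by (intro frac_eq_add_int[OF eq]) auto
    with back_left[OF fE(1) lt] have a: "t + h \<in> E" by simp
    \<comment> \<open>From \<open>t < x1\<close> follows \<open>t + h < x2\<close>, so
      \<open>t + h\<close> cannot lie beyond the hole.\<close>
    then have b: "t + h < x1" using E_hole[OF a] t by auto
    have eq: "t + h + \<alpha> + h = (f t + h) + of_int \<lfloor>t + \<alpha> + h\<rfloor>" by (simp add: f_coh frac_def)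
    then have "frac (t + h + \<alpha> + h) = f t + h"
      using fE lt x by (intro frac_eq_add_int[OF eq]) auto
    then have "f (t + h) = f t + h" using f_left[of "t + h"] b r x by simp
    then show ?thesis using a b lt by auto
  qed
  have "t + real n * h \<in> E \<and> t + real n * h < x1 \<and> f (t + real n * h) < 1 - x1" for n
  proof (induction n)
    case (Suc n)
    then show ?case using step[of "t + real n * h"] by (simp add: algebra_simps)
  qed (use assms contr in auto)
  then have "t + real n * h < x1" for n by blast
  moreover obtain n where "x1 - t < real n * h" using x reals_Archimedean3[of h] by auto
  ultimately show False by (metis add.commute diff_less_eq less_asym)
qed

lemma f_right_lands_left:
  assumes "t \<in> E" "x2 \<le> t"
  shows "f t < 1 - x2"
proof (rule ccontr)
  assume contr: "\<not> ?thesis"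
  have step: "t - h \<in> E \<and> x2 \<le> t - h \<and> 1 - x2 \<le> f (t - h)"
    if t: "t \<in> E" "x2 \<le> t" "1 - x2 \<le> f t" for t
  proof -
    have r: "0 \<le> t" "t < 1" using E_range[OF t(1)] by auto
    have f_coh: "f t = frac (t + \<alpha>)" using f_right r t by simp
    have fE: "f t \<in> E" "f t < 1" using f_in_E[OF t(1)] E_range by auto
    have lt: "1 - x1 \<le> f t" using E_reflected_hole[OF fE(1)] t by auto
    have eq: "f t - \<alpha> - h = (t - h) + of_int (- \<lfloor>t + \<alpha>\<rfloor>)" by (simp add: f_coh frac_def)
    then have "frac (f t - \<alpha> - h) = t - h" using r t x by (intro frac_eq_add_int[OF eq]) auto
    with back_right[OF fE(1) lt] have a: "t - h \<in> E" by simp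
    then have b: "x2 \<le> t - h" using E_hole[OF a] t by auto
    have eq: "t - h + \<alpha> = (f t - h) + of_int \<lfloor>t + \<alpha>\<rfloor>" by (simp add: f_coh frac_def)
    then have "frac (t - h + \<alpha>) = f t - h"
      using fE lt x by (intro frac_eq_add_int[OF eq]) auto
    then have "f (t - h) = f t - h" using f_right[of "t - h"] b by simp
    then show ?thesis using a b lt by auto
  qed
  have "t - real n * h \<in> E \<and> x2 \<le> t - real n * h \<and> 1 - x2 \<le> f (t - real n * h)" for n
  proof (induction n)
    case (Suc n)
    then show ?case using step[of "t - real n * h"] by (simp add: algebra_simps)
  qed (use assms contr in auto)
  then have "x2 \<le> t - real n * h" for n by blast
  moreover obtain n where "t - x2 < real n * h" using x reals_Archimedean3[of h] by auto
  ultimately show False by (metis diff_less_eq le_diff_eq add.commute not_le)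
qed

text \<open>When \<open>E\<close> meets both sides of the hole, \<open>f\<close> acts on it as the rotation by \<open>\<alpha> + h\<close> of a
  circle of length \<open>1 + h\<close>.\<close>

lemma mixed_left:
  assumes "t \<in> E" "t < x1" "v \<in> E" "x2 \<le> v"
  shows "t + \<alpha> + h < 1" "f t = t + \<alpha> + h"
proof -
  have t: "f t = frac (t + \<alpha> + h)" "0 \<le> t" "t < 1"
    using assms E_range[of t] f_left by auto
  have v: "f v = frac (v + \<alpha>)" "v < 1" using assms E_range[of v] f_right by auto
  have l: "1 - x1 \<le> f t" "f v < 1 - x2"
    using assms f_left_lands_right f_right_lands_left by auto
  \<comment> \<open>Otherwise both \<open>t + \<alpha> + h\<close> and \<open>v + \<alpha>\<close>
    wrap, and \<open>t + h < x2 \<le> v\<close> gives \<open>f t < f v\<close>; but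
    \<open>f v\<close> lies before the reflected hole and \<open>f t\<close> after it.\<close>
  show "t + \<alpha> + h < 1"
  proof (rule ccontr)
    assume "\<not> ?thesis"
    then have "frac (t + \<alpha> + h) = t + \<alpha> + h - 1" "frac (v + \<alpha>) = v + \<alpha> - 1"
      using assms t v \<alpha> x by (auto intro!: frac_eq_add_int[where k = 1])
    then show False using l t v assms x by auto
  qed
  then show "f t = t + \<alpha> + h"
    unfolding t using t \<alpha> x by (intro frac_eq_add_int[where k = 0]) auto
qed

lemma mixed_right:
  assumes "t \<in> E" "x2 \<le> t" "u \<in> E" "u < x1"
  shows "1 \<le> t + \<alpha>" "f t = t + \<alpha> - 1"
proof -
  have t: "f t = frac (t + \<alpha>)" "0 \<le> t" "t < 1"
    using assms E_range[of t] f_right by auto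
  have u: "f u = u + \<alpha> + h" using mixed_left assms by blast
  have l: "1 - x1 \<le> f u" "f t < 1 - x2"
    using assms f_left_lands_right f_right_lands_left by auto
  \<comment> \<open>Without wrapping, \<open>f t = t + \<alpha> > u + \<alpha> + h = f u\<close>,
    although \<open>f t\<close> lies before the reflected hole and \<open>f u\<close> after
    it.\<close>
  show "1 \<le> t + \<alpha>"
  proof (rule ccontr)
    assume "\<not> ?thesis"
    then have "frac (t + \<alpha>) = t + \<alpha>"
      using assms t \<alpha> x by (auto intro!: frac_eq_add_int[where k = 0])
    then show False using l t u assms x by auto
  qed
  then show "f t = t + \<alpha> - 1"
    unfolding t using t \<alpha> x by (intro frac_eq_add_int[where k = 1]) auto
qed

lemma mixed_rotation:
  assumes "u \<in> E" "u < x1" "v \<in> E" "x2 \<le> v" "t \<in> E"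
  shows "f t = (1 + h) * frac ((t + (\<alpha> + h)) / (1 + h))"
proof -
  have h: "1 + h > 0" using x by simp
  have fE: "0 \<le> f t" "f t < 1" using f_in_E[OF assms(5)] E_range by auto
  have "frac ((t + (\<alpha> + h)) / (1 + h)) = f t / (1 + h)"
  proof (cases "t < x1")
    case True
    then have "(t + (\<alpha> + h)) / (1 + h) = f t / (1 + h) + of_int 0"
      using mixed_left assms by (simp add: add.assoc)
    then show ?thesis using fE h x by (intro frac_eq_add_int) auto
  next
    case False
    then have "x2 \<le> t" using E_hole assms by auto
    \<comment> \<open>Since \<open>\<alpha> - 1 = (\<alpha> + h) - (1 + h)\<close>, the right branch
      is the same rotation as the left one, less one turn of the longer circle.\<close>
    then have "f t = t + (\<alpha> + h) - (1 + h)" using mixed_right(2)[of t u] assms by simp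
    then have "(t + (\<alpha> + h)) / (1 + h) = f t / (1 + h) + of_int 1"
      using h by (simp add: field_simps)
    then show ?thesis using fE h x by (intro frac_eq_add_int) auto
  qed
  then show ?thesis using h by simp
qed

lemma mixed_rational:
  assumes "u \<in> E" "u < x1" "v \<in> E" "x2 \<le> v"
  shows "(\<alpha> + h) / (1 + h) \<in> \<rat>"
proof (rule rotation_rational[where X = E and a = x1 and b = x2])
  show "0 < 1 + h" using x by simp
  show "E \<subseteq> {0..<1 + h}" using E_range x by force
  show "E \<noteq> {}" using assms by blast
  show "(1 + h) * frac ((y + (\<alpha> + h)) / (1 + h)) \<in> E" if "y \<in> E" for y
    using mixed_rotation[OF assms that] f_in_E[OF that] by simp
  show "E \<inter> {x1..<x2} = {}" using E_hole by force
qed (use x in auto)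

text \<open>In a coset of spacing \<open>P\<close>, \<open>f\<close> raises the index by
  \<open>N\<close> modulo \<open>M\<close>. The points that wrap are those right of the hole, so
  these are exactly the last \<open>N\<close>. Because
  \<open>real (M - N) * P = 1 - \<alpha>\<close>, the number \<open>\<delta>\<close> is
  \<open>x2 - (1 - \<alpha>)\<close>.\<close>

lemma mixed_blocks:
  assumes "u \<in> E" "u < x1" "v \<in> E" "x2 \<le> v"
    and NM: "coprime N M" "N < M" "(\<alpha> + h) / (1 + h) = real N / real M"
    and t: "t \<in> E"
  defines "P \<equiv> (1 + h) / real M"
  defines "\<delta> \<equiv> x2 - real (M - N) * P"
  obtains r k where "0 < N" "k < M" "t = r + real k * P" "\<bar>\<delta>\<bar> \<le> r" "r < P - h - \<bar>\<delta>\<bar>"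
proof -
  have h: "1 + h > 0" using x by simp
  have EQ: "E \<subseteq> {0..<1 + h}" using E_range x by force
  have closed: "(1 + h) * frac ((y + (\<alpha> + h)) / (1 + h)) \<in> E" if "y \<in> E" for y
    using mixed_rotation[OF assms(1-4) that] f_in_E[OF that] by simp
  have M0: "M > 0" using NM by simp
  obtain r k where r: "0 \<le> r" "r < P" "k < M" "t = r + real k * P"
    and all: "\<And>k. k < M \<Longrightarrow> r + real k * P \<in> E"
    using rotation_cosets[OF h EQ closed M0 NM(1,3) t] unfolding P_def by blast
  have P: "P > 0" "real M * P = 1 + h" "real N * P = \<alpha> + h"
    using h M0 NM(3) by (simp_all add: P_def field_simps)
  have N0: "0 < N" using P \<alpha> x by (cases N) auto
  have left: "r + real k * P < x1" if "k < M - N" for k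
  proof (rule ccontr)
    assume n: "\<not> ?thesis"
    have kE: "r + real k * P \<in> E" using all that by simp
    then have "x2 \<le> r + real k * P" using n E_hole by fastforce
    then have "1 \<le> r + real k * P + \<alpha>" using mixed_right(1)[OF kE _ assms(1,2)] by simp
    then have "real M * P \<le> r + real (k + N) * P" unfolding P(2) using P(3)
      by (simp add: algebra_simps)
    also have "\<dots> < real (k + N + 1) * P" using r by (simp add: algebra_simps)
    finally have "M < k + N + 1" by (simp only: mult_less_cancel_right_pos[OF P(1)] of_nat_less_iff)
    then show False using that by simp
  qed
  have right: "x2 \<le> r + real k * P" if "M - N \<le> k" "k < M" for k
  proof (rule ccontr)
    assume n: "\<not> ?thesis"
    have kE: "r + real k * P \<in> E" using all that by simp
    then have "r + real k * P < x1" using n E_hole by fastforce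
    then have "r + real k * P + \<alpha> + h < 1" using mixed_left(1)[OF kE _ assms(3,4)] by simp
    then have "r + real (k + N) * P < real M * P" unfolding P(2) using P(3) x
      by (simp add: algebra_simps)
    moreover have "real M * P \<le> real (k + N) * P"
      using that P by (intro mult_right_mono) auto
    ultimately show False using r(1) by linarith
  qed
  have MN: "real (M - N) = real M - real N" "real (M - N - 1) = real M - real N - 1"
    using NM by (simp_all add: of_nat_diff)
  have "real (M - N) * P = 1 + h - (\<alpha> + h)" unfolding MN left_diff_distrib P ..
  then have \<delta>: "x2 = 1 - \<alpha> + \<delta>" by (simp add: \<delta>_def)
  \<comment> \<open>Bounds 1 and 2 come from the two points next to the hole, 3 and 4 from the
    images of the first and last points, which are next to the reflected hole. In this order they
    become \<open>r < P - h + \<delta>\<close>, \<open>\<delta> \<le> r\<close>,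
    \<open>- \<delta> \<le> r\<close> and \<open>r < P - h - \<delta>\<close>.\<close>
  have 1: "r + real (M - N - 1) * P < x1" using left[of "M - N - 1"] NM by simp
  have 2: "x2 \<le> r + real (M - N) * P" using right[of "M - N"] NM N0 by simp
  have "f (r + real 0 * P) = r + real 0 * P + \<alpha> + h"
    using mixed_left(2)[OF all _ assms(3,4), of 0] left[of 0] NM by simp
  with f_left_lands_right[OF all left, of 0] NM have 3: "1 - x1 \<le> r + \<alpha> + h" by simp
  have M1: "M - N \<le> M - 1" "M - 1 < M" using N0 M0 by auto
  have "f (r + real (M - 1) * P) = r + real (M - 1) * P + \<alpha> - 1"
    by (rule mixed_right(2)[OF all right assms(1,2)]) (use M1 in auto)
  with f_right_lands_left[OF all right, OF M1(2) M1]
  have 4: "r + real (M - 1) * P + \<alpha> - 1 < 1 - x2" by simp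
  have "real (M - 1) * P = 1 + h - P" "real (M - N - 1) * P = 1 + h - (\<alpha> + h) - P"
    "real (M - N) * P = 1 + h - (\<alpha> + h)"
    using M0 NM(2) P(2,3) by (simp_all add: of_nat_diff algebra_simps)
  with 1 2 3 4 \<delta> have "\<bar>\<delta>\<bar> \<le> r" "r < P - h - \<bar>\<delta>\<bar>" by linarith+
  then show ?thesis using that N0 r by blast
qed

section \<open>Invariant sets on one side of the hole\<close>

lemma right_rational:
  assumes "E \<noteq> {}" "\<And>t. t \<in> E \<Longrightarrow> x2 \<le> t"
  shows "\<alpha> \<in> \<rat>"
proof -
  have "\<alpha> / 1 \<in> \<rat>"
  proof (rule rotation_rational[where X = E and a = x1 and b = x2])
    show "1 * frac ((y + \<alpha>) / 1) \<in> E" if "y \<in> E" for y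
      using f_in_E[OF that] f_right[OF assms(2)[OF that]] by simp
    show "E \<subseteq> {0..<1}" using E_range by auto
    show "E \<inter> {x1..<x2} = {}" using E_hole by force
  qed (use assms x in auto)
  then show ?thesis by simp
qed

text \<open>The lower bound on \<open>r\<close> holds because the first point of the coset lies
  right of the hole. The upper bound holds because the last point is an image under
  \<open>f\<close>, hence lies before the reflected hole.\<close>

lemma right_blocks:
  assumes "\<And>t. t \<in> E \<Longrightarrow> x2 \<le> t" and NM: "coprime N M" "N < M" "\<alpha> = real N / real M"
    and t: "t \<in> E"
  obtains r k where "k < M" "t = real k / real M + r" "x2 \<le> r" "r < 1 / real M - x2"
proof -
  have EQ: "E \<subseteq> {0..<1}" using E_range x by force
  have closed: "1 * frac ((y + \<alpha>) / 1) \<in> E" if "y \<in> E" for y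
    using f_in_E[OF that] f_right[OF assms(1)[OF that]] by simp
  have M0: "M > 0" and \<alpha>': "\<alpha> / 1 = real N / real M" using NM by simp_all
  obtain r k where r: "0 \<le> r" "r < 1 / M" "k < M" "t = r + real k * (1 / real M)"
    and all: "\<And>k. k < M \<Longrightarrow> r + real k * (1 / real M) \<in> E"
    by (rule rotation_cosets[OF zero_less_one EQ closed M0 NM(1) \<alpha>' t]) blast+
  have "x2 \<le> r" using assms(1)[OF all, of 0] M0 by simp
  moreover obtain s where "s \<in> E" "f s = r + real (M - 1) * (1 / real M)"
    using f_onto_E[OF all, of "M - 1"] M0 by auto
  then have "r + real (M - 1) * (1 / real M) < 1 - x2"
    using f_right_lands_left[OF _ assms(1)] by metis
  then have "r < 1 / real M - x2" using M0 by (simp add: of_nat_diff field_simps)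
  ultimately show ?thesis using that r by simp
qed

lemma left_rational:
  assumes "E \<noteq> {}" "\<And>t. t \<in> E \<Longrightarrow> t < x1"
  shows "frac (\<alpha> + h) \<in> \<rat>"
proof -
  have "(\<alpha> + h) / 1 \<in> \<rat>"
  proof (rule rotation_rational[where X = E and a = x1 and b = x2])
    show "1 * frac ((y + (\<alpha> + h)) / 1) \<in> E" if "y \<in> E" for y
      using f_in_E[OF that] f_left[OF E_range(1)[OF that] assms(2)[OF that]]
      by (simp add: algebra_simps)
    show "E \<subseteq> {0..<1}" using E_range by auto
    show "E \<inter> {x1..<x2} = {}" using E_hole by force
  qed (use assms x in auto)
  then show ?thesis by (simp add: frac_def)
qed

text \<open>Dual to the right side: the first point of the coset is an image under \<open>f\<close>,
  hence lies after the reflected hole, and the last one lies left of the hole. The angle is reduced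
  modulo 1 because \<open>\<alpha> + h\<close> may reach or exceed 1.\<close>

lemma left_blocks:
  assumes "\<And>t. t \<in> E \<Longrightarrow> t < x1"
    and NM: "coprime N M" "N < M" "frac (\<alpha> + h) = real N / real M"
    and t: "t \<in> E"
  obtains r k where "k < M" "t = real k / real M + r" "1 - x1 \<le> r"
    "r < x1 - (real M - 1) / real M"
proof -
  have EQ: "E \<subseteq> {0..<1}" using E_range x by force
  have closed: "1 * frac ((y + frac (\<alpha> + h)) / 1) \<in> E" if "y \<in> E" for y
  proof -
    have "frac (y + frac (\<alpha> + h)) = frac (y + \<alpha> + h)"
      by (simp add: frac_def[of "\<alpha> + h"] algebra_simps flip: frac_add_int_right)
    then show ?thesis
      using f_in_E[OF that] f_left[OF E_range(1)[OF that] assms(1)[OF that]] by simp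
  qed
  have M0: "M > 0" and \<alpha>': "frac (\<alpha> + h) / 1 = real N / real M" using NM by simp_all
  obtain r k where r: "0 \<le> r" "r < 1 / M" "k < M" "t = r + real k * (1 / real M)"
    and all: "\<And>k. k < M \<Longrightarrow> r + real k * (1 / real M) \<in> E"
    by (rule rotation_cosets[OF zero_less_one EQ closed M0 NM(1) \<alpha>' t]) blast+
  obtain s where "s \<in> E" "f s = r + real 0 * (1 / real M)"
    using f_onto_E[OF all, of 0] M0 by auto
  then have "1 - x1 \<le> r" using f_left_lands_right[OF _ assms(1), of s] by simp
  moreover have "r + real (M - 1) * (1 / real M) < x1" using assms(1)[OF all, of "M - 1"] M0 by simp
  then have "r < x1 - (real M - 1) / real M" using M0 by (simp add: of_nat_diff)
  ultimately show ?thesis using that r by simp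
qed

end

subsection \<open>Unions of equally spaced blocks\<close>

lemma frac_star_eq_add_int:
  assumes "x = y + of_int k" "0 < y" "y \<le> 1"
  shows "frac_star x = y"
proof -
  have "1 - x = (1 - y) + of_int (- k)" using assms by simp
  then have "frac (1 - x) = 1 - y" by (rule frac_eq_add_int) (use assms in auto)
  then show ?thesis by (simp add: frac_star_def)
qed

definition blocks :: "nat \<Rightarrow> real \<Rightarrow> real \<Rightarrow> real \<Rightarrow> real set" where
  "blocks M P a b = (\<Union>k<M. (+) (real k * P) ` {a..<b})"

lemma mem_blocks: "t \<in> blocks M P a b \<longleftrightarrow> (\<exists>k<M. \<exists>r. a \<le> r \<and> r < b \<and> t = r + real k * P)"
proof -
  have "t \<in> (+) (real k * P) ` {a..<b} \<longleftrightarrow> (\<exists>r. a \<le> r \<and> r < b \<and> t = r + real k * P)" for k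
    by (auto intro!: exI[of _ "t - real k * P"])
  then show ?thesis unfolding blocks_def by (simp add: Bex_def)
qed

lemma mem_reflect: "t \<in> reflect A \<longleftrightarrow> 1 - t \<in> A"
proof
  assume "1 - t \<in> A"
  then have "1 - (1 - t) \<in> reflect A" unfolding reflect_def by (rule imageI)
  then show "t \<in> reflect A" by simp
qed (auto simp: reflect_def)

text \<open>The hypothesis makes the closed blocks symmetric about 1/2. Reflection sends index
  \<open>k\<close> to \<open>M - 1 - k\<close> and offset \<open>r\<close> to
  \<open>a + b - r\<close>, so only the included endpoint changes.\<close>

lemma mem_reflect_blocks:
  assumes ab: "a + b = 1 - (real M - 1) * P"
  shows "t \<in> reflect (blocks M P a b) \<longleftrightarrow> (\<exists>k<M. \<exists>r. a < r \<and> r \<le> b \<and> t = r + real k * P)"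
proof
  assume "t \<in> reflect (blocks M P a b)"
  then obtain k r where k: "k < M" "a \<le> r" "r < b" "1 - t = r + real k * P"
    by (auto simp: mem_reflect mem_blocks)
  have "t = (a + b - r) + real (M - 1 - k) * P"
    using k ab by (simp add: of_nat_diff algebra_simps)
  then show "\<exists>k<M. \<exists>r. a < r \<and> r \<le> b \<and> t = r + real k * P"
    using k by (intro exI[of _ "M - 1 - k"] conjI exI[of _ "a + b - r"]) auto
next
  assume "\<exists>k<M. \<exists>r. a < r \<and> r \<le> b \<and> t = r + real k * P"
  then obtain k r where k: "k < M" "a < r" "r \<le> b" "t = r + real k * P" by auto
  have "1 - t = (a + b - r) + real (M - 1 - k) * P"
    using k ab by (simp add: of_nat_diff algebra_simps)
  then show "t \<in> reflect (blocks M P a b)"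
    unfolding mem_reflect mem_blocks
    using k by (intro exI[of _ "M - 1 - k"] conjI exI[of _ "a + b - r"]) auto
qed

lemma mod_shift_onto:
  fixes k M N :: nat
  assumes "k < M"
  obtains l where "l < M" "(l + N) mod M = k"
proof
  define l where "l = (k + (M - N mod M)) mod M"
  show "l < M" using assms by (simp add: l_def)
  have "N mod M < M" using assms by simp
  then have "k + (M - N mod M) + N mod M = k + M" by simp
  then have "(k + (M - N mod M) + N) mod M = k"
    using assms by (metis mod_add_right_eq mod_add_self2 mod_less)
  then show "(l + N) mod M = k" by (simp add: l_def mod_add_left_eq)
qed

lemma mod_shift_mult:
  assumes "k < M" "N < M"
  shows "real ((k + N) mod M) * P
    = real k * P + real N * P - (if k + N < M then 0 else real M * P)"
proof (cases "k + N < M")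
  case False
  then have "(k + N) mod M = k + N - M" using assms by (simp add: mod_if)
  then show ?thesis using False by (simp add: of_nat_diff algebra_simps)
qed (simp add: algebra_simps)

lemma mult_le_last:
  fixes P :: real
  assumes "k < M" "0 \<le> P"
  shows "real k * P \<le> real M * P - P"
proof -
  have "real k \<le> real M - 1" using assms(1) by linarith
  then have "real k * P \<le> (real M - 1) * P" using assms(2) by (rule mult_right_mono)
  then show ?thesis by (simp add: algebra_simps)
qed

text \<open>The offset condition \<open>Q\<close> is left open to serve left-closed blocks, their
  right-closed reflections, and the finite cycle of left endpoints.\<close>

lemma image_blocks_shift:
  assumes "N < M" "\<And>r k. Q r \<Longrightarrow> k < M \<Longrightarrow> g (r + real k * P) = r + real ((k + N) mod M) * P"
  shows "g ` {t. \<exists>k<M. \<exists>r. Q r \<and> t = r + real k * P} = {t. \<exists>k<M. \<exists>r. Q r \<and> t = r + real k * P}"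
    (is "g ` ?A = ?A")
proof
  show "g ` ?A \<subseteq> ?A"
  proof clarify
    fix k r assume k: "k < M" "Q r"
    then have "(k + N) mod M < M" by simp
    then show "\<exists>k'<M. \<exists>r'. Q r' \<and> g (r + real k * P) = r' + real k' * P"
      using assms(2) k by blast
  qed
  show "?A \<subseteq> g ` ?A"
  proof clarify
    fix k r assume k: "k < M" "Q r"
    obtain l where l: "l < M" "(l + N) mod M = k" using mod_shift_onto[OF k(1)] .
    then have "r + real k * P = g (r + real l * P)" using assms(2) k by simp
    then show "r + real k * P \<in> g ` ?A" using l k by blast
  qed
qed

section \<open>Invariance of the blocks in each of the three cases\<close>

context hole
begin

abbreviation f_coh :: "real \<Rightarrow> real" where "f_coh \<equiv> coherent_map \<alpha> x1 x2"

lemma f_coh_left: "0 < t \<Longrightarrow> t \<le> x1 \<Longrightarrow> f_coh t = frac_star (t + \<alpha> + h)"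
  by (simp add: coherent_map_def algebra_simps)

lemma f_coh_right: "x2 < t \<Longrightarrow> f_coh t = frac_star (t + \<alpha>)"
  using x by (simp add: coherent_map_def)

text \<open>Reduces symmetric invariance to arithmetic on a single point: both maps keep the offset
  and shift the index by \<open>N\<close> modulo \<open>M\<close>, one on left-closed blocks, the
  other on right-closed ones.\<close>

lemma blocks_sym_invariant:
  assumes "N < M" and ab: "a + b = 1 - (real M - 1) * P"
    and f: "\<And>r k. a \<le> r \<Longrightarrow> r < b \<Longrightarrow> k < M \<Longrightarrow>
      0 \<le> r + real k * P \<and> r + real k * P < 1 \<and>
      (r + real k * P < x1 \<or> x2 \<le> r + real k * P) \<and>
      f (r + real k * P) = r + real ((k + N) mod M) * P"
    and f_coh: "\<And>r k. a < r \<Longrightarrow> r \<le> b \<Longrightarrow> k < M \<Longrightarrow>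
      (r + real k * P \<le> x1 \<or> x2 < r + real k * P) \<and>
      f_coh (r + real k * P) = r + real ((k + N) mod M) * P"
  shows "sym_invariant_off_hole \<alpha> x1 x2 (blocks M P a b)"
proof -
  have J: "blocks M P a b = {t. \<exists>k<M. \<exists>r. (a \<le> r \<and> r < b) \<and> t = r + real k * P}"
    by (simp add: set_eq_iff mem_blocks conj_assoc)
  have J': "reflect (blocks M P a b) = {t. \<exists>k<M. \<exists>r. (a < r \<and> r \<le> b) \<and> t = r + real k * P}"
    by (simp add: set_eq_iff mem_reflect_blocks[OF ab] conj_assoc)
  have "hole_map \<alpha> x1 x2 ` blocks M P a b = blocks M P a b"
    unfolding J by (rule image_blocks_shift[OF assms(1)]) (use f in blast)
  moreover have "f_coh ` reflect (blocks M P a b) = reflect (blocks M P a b)"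
    unfolding J' by (rule image_blocks_shift[OF assms(1)]) (use f_coh in blast)
  moreover have "t \<in> {0..<1} - ({x1..<x2} \<union> reflect {x1<..x2})" if "t \<in> blocks M P a b" for t
  proof -
    have "0 \<le> t \<and> t < 1 \<and> (t < x1 \<or> x2 \<le> t)" using that f by (auto simp: mem_blocks)
    \<comment> \<open>Avoiding the reflected hole is read off at the mirror image of
      \<open>t\<close>, where the assumption on \<open>f_coh\<close> excludes the right-closed
      hole.\<close>
    moreover have "1 - t \<in> reflect (blocks M P a b)" using that by (simp add: mem_reflect)
    then obtain k r where "k < M" "a < r" "r \<le> b" "1 - t = r + real k * P"
      unfolding mem_reflect_blocks[OF ab] by blast
    then have "1 - t \<le> x1 \<or> x2 < 1 - t" using f_coh[of r k] by simp
    ultimately show ?thesis by (auto simp: mem_reflect)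
  qed
  ultimately show ?thesis unfolding sym_invariant_off_hole_def by blast
qed

text \<open>By \<open>x2 \<le> r\<close> all blocks lie right of the hole, where \<open>f\<close> is
  the rotation by \<open>N / M\<close>.\<close>

lemma case_i_blocks:
  assumes "N < M" "case_i N M \<alpha> x1 x2"
  defines "P \<equiv> 1 / real M"
  shows "sym_invariant_off_hole \<alpha> x1 x2 (blocks M P x2 (P - x2))"
    and "x2 < P - x2"
    and "x2 \<le> r \<Longrightarrow> r < P - x2 \<Longrightarrow> k < M \<Longrightarrow> f (r + real k * P) = r + real ((k + N) mod M) * P"
proof -
  have P: "P > 0" "real M * P = 1" "\<alpha> = real N * P"
    using assms by (simp_all add: P_def case_i_def)
  show "x2 < P - x2" using assms by (simp add: case_i_def P_def field_simps)
  have f: "0 \<le> r + real k * P \<and> r + real k * P < 1 \<and>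
      (r + real k * P < x1 \<or> x2 \<le> r + real k * P) \<and>
      f (r + real k * P) = r + real ((k + N) mod M) * P"
    if r: "x2 \<le> r" "r < P - x2" "k < M" for r k
  proof -
    have kP: "0 \<le> real k * P" "real k * P \<le> 1 - P" using mult_le_last[OF r(3), of P] P by auto
    have "(k + N) mod M < M" using r(3) by simp
    then have jP: "0 \<le> real ((k + N) mod M) * P" "real ((k + N) mod M) * P \<le> 1 - P"
      using mult_le_last[of "(k + N) mod M" M P] P by auto
    have "f (r + real k * P) = frac (r + real k * P + \<alpha>)" using r kP by (intro f_right; linarith)
    also have "\<dots> = r + real ((k + N) mod M) * P"
      by (rule frac_eq_add_int[where k = "if k + N < M then 0 else 1"])
        (use mod_shift_mult[OF r(3) assms(1), of P] P r x jP in auto)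
    moreover have "0 \<le> r + real k * P" "r + real k * P < 1" "x2 \<le> r + real k * P"
      using r kP x by linarith+
    ultimately show ?thesis by simp
  qed
  have f_coh: "(r + real k * P \<le> x1 \<or> x2 < r + real k * P) \<and>
      f_coh (r + real k * P) = r + real ((k + N) mod M) * P"
    if r: "x2 < r" "r \<le> P - x2" "k < M" for r k
  proof -
    have kP: "0 \<le> real k * P" "real k * P \<le> 1 - P" using mult_le_last[OF r(3), of P] P by auto
    have "(k + N) mod M < M" using r(3) by simp
    then have jP: "0 \<le> real ((k + N) mod M) * P" "real ((k + N) mod M) * P \<le> 1 - P"
      using mult_le_last[of "(k + N) mod M" M P] P by auto
    have "f_coh (r + real k * P) = frac_star (r + real k * P + \<alpha>)" using r kP by (intro f_coh_right; linarith)
    also have "\<dots> = r + real ((k + N) mod M) * P"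
      by (rule frac_star_eq_add_int[where k = "if k + N < M then 0 else 1"])
        (use mod_shift_mult[OF r(3) assms(1), of P] P r x jP in auto)
    moreover have "x2 < r + real k * P" using r kP by linarith
    ultimately show ?thesis by simp
  qed
  show "sym_invariant_off_hole \<alpha> x1 x2 (blocks M P x2 (P - x2))"
    by (rule blocks_sym_invariant[OF assms(1) _ f f_coh]) (use P in \<open>auto simp: algebra_simps\<close>)
  show "x2 \<le> r \<Longrightarrow> r < P - x2 \<Longrightarrow> k < M \<Longrightarrow> f (r + real k * P) = r + real ((k + N) mod M) * P"
    using f by blast
qed

lemma case_ii_shift:
  assumes "case_ii N M \<alpha> x1 x2"
  obtains l :: int where "\<alpha> + h = real N / real M + of_int l"
proof
  show "\<alpha> + h = real N / real M + of_int (- \<lfloor>real N / real M - h\<rfloor>)"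
    using assms by (simp add: case_ii_def frac_def)
qed

text \<open>The bound \<open>r < P - (1 - x1)\<close> keeps even the last block below
  \<open>x1\<close>, so only the left branch acts. It is a rotation by \<open>N / M\<close>; the
  integer \<open>l\<close> absorbs the reduction modulo 1 in the formula for
  \<open>\<alpha>\<close>.\<close>

lemma case_ii_blocks:
  assumes "N < M" "case_ii N M \<alpha> x1 x2"
  defines "P \<equiv> 1 / real M"
  shows "sym_invariant_off_hole \<alpha> x1 x2 (blocks M P (1 - x1) (P - (1 - x1)))"
    and "1 - x1 < P - (1 - x1)"
    and "1 - x1 \<le> r \<Longrightarrow> r < P - (1 - x1) \<Longrightarrow> k < M \<Longrightarrow>
      f (r + real k * P) = r + real ((k + N) mod M) * P"
    and "1 - x1 \<le> r \<Longrightarrow> r < P - (1 - x1) \<Longrightarrow> k < M \<Longrightarrow> r + real k * P < x1"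
proof -
  obtain l :: int where "\<alpha> + h = real N / real M + of_int l" using case_ii_shift[OF assms(2)] .
  then have P: "P > 0" "real M * P = 1" "\<alpha> + h = real N * P + of_int l"
    using assms(1) by (simp_all add: P_def)
  show "1 - x1 < P - (1 - x1)" using assms by (simp add: case_ii_def P_def field_simps)
  have f: "0 \<le> r + real k * P \<and> r + real k * P < 1 \<and>
      (r + real k * P < x1 \<or> x2 \<le> r + real k * P) \<and>
      f (r + real k * P) = r + real ((k + N) mod M) * P \<and> r + real k * P < x1"
    if r: "1 - x1 \<le> r" "r < P - (1 - x1)" "k < M" for r k
  proof -
    have kP: "0 \<le> real k * P" "real k * P \<le> 1 - P" using mult_le_last[OF r(3), of P] P by auto
    have "(k + N) mod M < M" using r(3) by simp
    then have jP: "0 \<le> real ((k + N) mod M) * P" "real ((k + N) mod M) * P \<le> 1 - P"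
      using mult_le_last[of "(k + N) mod M" M P] P by auto
    have "f (r + real k * P) = frac (r + real k * P + \<alpha> + h)"
      using r kP x by (intro f_left; linarith)
    also have "\<dots> = r + real ((k + N) mod M) * P"
      by (rule frac_eq_add_int[where k = "l + (if k + N < M then 0 else 1)"])
        (use mod_shift_mult[OF r(3) assms(1), of P] P r x jP in auto)
    moreover have "0 \<le> r + real k * P" "r + real k * P < 1" "r + real k * P < x1"
      using r kP x by linarith+
    ultimately show ?thesis by simp
  qed
  have f_coh: "(r + real k * P \<le> x1 \<or> x2 < r + real k * P) \<and>
      f_coh (r + real k * P) = r + real ((k + N) mod M) * P"
    if r: "1 - x1 < r" "r \<le> P - (1 - x1)" "k < M" for r k
  proof -
    have kP: "0 \<le> real k * P" "real k * P \<le> 1 - P" using mult_le_last[OF r(3), of P] P by auto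
    have "(k + N) mod M < M" using r(3) by simp
    then have jP: "0 \<le> real ((k + N) mod M) * P" "real ((k + N) mod M) * P \<le> 1 - P"
      using mult_le_last[of "(k + N) mod M" M P] P by auto
    have "f_coh (r + real k * P) = frac_star (r + real k * P + \<alpha> + h)"
      using r kP x by (intro f_coh_left; linarith)
    also have "\<dots> = r + real ((k + N) mod M) * P"
      by (rule frac_star_eq_add_int[where k = "l + (if k + N < M then 0 else 1)"])
        (use mod_shift_mult[OF r(3) assms(1), of P] P r x jP in auto)
    moreover have "r + real k * P \<le> x1" using r kP by linarith
    ultimately show ?thesis by simp
  qed
  show "sym_invariant_off_hole \<alpha> x1 x2 (blocks M P (1 - x1) (P - (1 - x1)))"
    by (rule blocks_sym_invariant[OF assms(1) _ _ f_coh])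
      (use P f in \<open>auto simp: algebra_simps\<close>)
  show "1 - x1 \<le> r \<Longrightarrow> r < P - (1 - x1) \<Longrightarrow> k < M \<Longrightarrow>
      f (r + real k * P) = r + real ((k + N) mod M) * P"
    "1 - x1 \<le> r \<Longrightarrow> r < P - (1 - x1) \<Longrightarrow> k < M \<Longrightarrow> r + real k * P < x1"
    using f by blast+
qed

text \<open>In terms of the spacing \<open>P\<close> the formulas of this case become linear, and
  the bound on \<open>\<delta>\<close> says that the block
  \<open>[\<bar>\<delta>\<bar>, P - h - \<bar>\<delta>\<bar>)\<close> is nonempty.\<close>

lemma case_iii_parameters:
  assumes "N < M" "case_iii N M \<Delta> \<delta> \<alpha> x1 x2"
  defines "P \<equiv> (1 + h) / real M"
  shows "\<Delta> = h" "P > 0" "real M * P = 1 + h" "real N * P = \<alpha> + h" "x2 = 1 - \<alpha> + \<delta>"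
    "2 * \<bar>\<delta>\<bar> < P - h"
proof -
  have M: "real M > 0" using assms(1) by simp
  have c: "x1 = (real M - real N) / real M - real N / real M * \<Delta> + \<delta>"
    "x2 = (real M - real N) / real M * (1 + \<Delta>) + \<delta>"
    "\<alpha> = real N / real M - (real M - real N) / real M * \<Delta>"
    "\<bar>\<delta>\<bar> < 1 / (2 * real M) - (real M - 1) / (2 * real M) * \<Delta>"
    using assms(2) by (simp_all add: case_iii_def)
  have "x2 - x1 = \<Delta>" unfolding c(1,2) using M by (simp add: field_simps)
  then show \<Delta>: "\<Delta> = h" by simp
  show "P > 0" "real M * P = 1 + h" using M x by (simp_all add: P_def)
  show "real N * P = \<alpha> + h" unfolding c(3) \<Delta> P_def using M by (simp add: field_simps)
  have "x2 = 1 - \<alpha> + \<delta>" unfolding c(2,3) using M by (simp add: field_simps)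
  then show "x2 = 1 - \<alpha> + \<delta>" .
  show "2 * \<bar>\<delta>\<bar> < P - h" using c(4) M unfolding \<Delta> P_def by (simp add: field_simps)
qed

text \<open>Consecutive blocks leave a gap of length \<open>h + 2 * \<bar>\<delta>\<bar>\<close>.
  The gap before index \<open>M - N\<close> contains the hole for either sign of
  \<open>\<delta>\<close>, since
  \<open>real (M - N) * P = 1 - \<alpha> = x2 - \<delta>\<close>.\<close>

lemma case_iii_blocks:
  assumes "N < M" "case_iii N M \<Delta> \<delta> \<alpha> x1 x2"
  defines "P \<equiv> (1 + h) / real M"
  shows "sym_invariant_off_hole \<alpha> x1 x2 (blocks M P \<bar>\<delta>\<bar> (P - h - \<bar>\<delta>\<bar>))"
    and "\<bar>\<delta>\<bar> \<le> r \<Longrightarrow> r < P - h - \<bar>\<delta>\<bar> \<Longrightarrow> k < M \<Longrightarrow>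
      f (r + real k * P) = r + real ((k + N) mod M) * P"
    and "\<bar>\<delta>\<bar> \<le> r \<Longrightarrow> r < P - h - \<bar>\<delta>\<bar> \<Longrightarrow> k < M \<Longrightarrow> r + real k * P < x1 \<longleftrightarrow> k < M - N"
proof -
  note P = case_iii_parameters[OF assms(1,2), folded P_def]
  have left: "real k * P \<le> 1 - \<alpha> - P" if "k < M - N" for k
  proof -
    have "real k * P \<le> real (M - N) * P - P" using mult_le_last[OF that] P by simp
    then show ?thesis using assms(1) P by (simp add: of_nat_diff left_diff_distrib)
  qed
  have right: "1 - \<alpha> \<le> real k * P" if "\<not> k < M - N" for k
  proof -
    have "real (M - N) * P \<le> real k * P" using that P by (intro mult_right_mono) auto
    then show ?thesis using assms(1) P by (simp add: of_nat_diff left_diff_distrib)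
  qed
  have f: "0 \<le> r + real k * P \<and> r + real k * P < 1 \<and>
      (r + real k * P < x1 \<or> x2 \<le> r + real k * P) \<and>
      f (r + real k * P) = r + real ((k + N) mod M) * P \<and>
      (r + real k * P < x1 \<longleftrightarrow> k < M - N)"
    if r: "\<bar>\<delta>\<bar> \<le> r" "r < P - h - \<bar>\<delta>\<bar>" "k < M" for r k
  proof -
    have kP: "0 \<le> real k * P" "real k * P \<le> 1 + h - P"
      using mult_le_last[OF r(3), of P] P by auto
    have "(k + N) mod M < M" using r(3) by simp
    then have jP: "0 \<le> real ((k + N) mod M) * P" "real ((k + N) mod M) * P \<le> 1 + h - P"
      using mult_le_last[of "(k + N) mod M" M P] P by auto
    show ?thesis
    proof (cases "k < M - N")
      case True
      have lt: "r + real k * P < x1" using left[OF True] r P(5) by auto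
      then have "f (r + real k * P) = frac (r + real k * P + \<alpha> + h)"
        using r kP by (intro f_left; linarith)
      also have "\<dots> = r + real ((k + N) mod M) * P"
        by (rule frac_eq_add_int[where k = 0])
          (use mod_shift_mult[OF r(3) assms(1), of P] True P(4) r jP in auto)
      moreover have "0 \<le> r + real k * P" "r + real k * P < 1" using lt r kP x by linarith+
      ultimately show ?thesis using lt True by simp
    next
      case False
      have gt: "x2 \<le> r + real k * P" using right[OF False] r P(5) by auto
      then have "f (r + real k * P) = frac (r + real k * P + \<alpha>)" by (rule f_right)
      \<comment> \<open>Wrapping is right here because
        \<open>\<alpha> - 1 = real N * P - real M * P\<close>: the index drops by
        \<open>M - N\<close>.\<close>
      also have "\<dots> = r + real ((k + N) mod M) * P"
        by (rule frac_eq_add_int[where k = 1])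
          (use mod_shift_mult[OF r(3) assms(1), of P] False P(3,4) r jP in auto)
      moreover have "0 \<le> r + real k * P" "r + real k * P < 1" "\<not> r + real k * P < x1"
        using gt r kP x by linarith+
      ultimately show ?thesis using gt False by simp
    qed
  qed
  have f_coh: "(r + real k * P \<le> x1 \<or> x2 < r + real k * P) \<and>
      f_coh (r + real k * P) = r + real ((k + N) mod M) * P"
    if r: "\<bar>\<delta>\<bar> < r" "r \<le> P - h - \<bar>\<delta>\<bar>" "k < M" for r k
  proof -
    have kP: "0 \<le> real k * P" using P by auto
    have "(k + N) mod M < M" using r(3) by simp
    then have jP: "0 \<le> real ((k + N) mod M) * P" "real ((k + N) mod M) * P \<le> 1 + h - P"
      using mult_le_last[of "(k + N) mod M" M P] P by auto
    show ?thesis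
    proof (cases "k < M - N")
      case True
      have lt: "r + real k * P \<le> x1" using left[OF True] r P(5) by auto
      then have "f_coh (r + real k * P) = frac_star (r + real k * P + \<alpha> + h)"
        using r kP by (intro f_coh_left; linarith)
      also have "\<dots> = r + real ((k + N) mod M) * P"
        by (rule frac_star_eq_add_int[where k = 0])
          (use mod_shift_mult[OF r(3) assms(1), of P] True P(4) r jP in auto)
      finally show ?thesis using lt by simp
    next
      case False
      have gt: "x2 < r + real k * P" using right[OF False] r P(5) by auto
      then have "f_coh (r + real k * P) = frac_star (r + real k * P + \<alpha>)" by (rule f_coh_right)
      also have "\<dots> = r + real ((k + N) mod M) * P"
        by (rule frac_star_eq_add_int[where k = 1])
          (use mod_shift_mult[OF r(3) assms(1), of P] False P(3,4) r jP in auto)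
      finally show ?thesis using gt by simp
    qed
  qed
  show "sym_invariant_off_hole \<alpha> x1 x2 (blocks M P \<bar>\<delta>\<bar> (P - h - \<bar>\<delta>\<bar>))"
    by (rule blocks_sym_invariant[OF assms(1) _ _ f_coh])
      (use P f in \<open>auto simp: left_diff_distrib\<close>)
  show "\<bar>\<delta>\<bar> \<le> r \<Longrightarrow> r < P - h - \<bar>\<delta>\<bar> \<Longrightarrow> k < M \<Longrightarrow>
      f (r + real k * P) = r + real ((k + N) mod M) * P"
    "\<bar>\<delta>\<bar> \<le> r \<Longrightarrow> r < P - h - \<bar>\<delta>\<bar> \<Longrightarrow> k < M \<Longrightarrow> r + real k * P < x1 \<longleftrightarrow> k < M - N"
    using f by blast+
qed

end

subsection \<open>The rotation number\<close>

lemma measure_Un_disjoint: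
  "A \<in> fmeasurable M \<Longrightarrow> B \<in> fmeasurable M \<Longrightarrow> A \<inter> B = {} \<Longrightarrow>
    measure M (A \<union> B) = measure M A + measure M B"
  by (simp add: measure_Un2 Diff_triv Int_commute)

context hole
begin

definition off_hole :: "real set" where "off_hole = {0..<1} - {x1..<x2}"

abbreviation S :: "real set" where "S \<equiv> max_invariant \<alpha> x1 x2"

text \<open>The value of \<open>f\<close> before reduction modulo 1. It closes up the hole: it is
  strictly increasing on \<open>off_hole\<close> and maps it into an interval shorter than 1, so
  \<open>f\<close> is injective there and keeps the cyclic order.\<close>

definition f_lift :: "real \<Rightarrow> real" where
  "f_lift t = (if t < x1 then t + \<alpha> + h else t + \<alpha>)"

text \<open>\<open>unwrap\<close> inverts \<open>frac\<close> on \<open>[\<alpha>, \<alpha> + 1)\<close>, an interval that contains \<open>f_lift ` off_hole\<close>.\<close>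

definition unwrap :: "real \<Rightarrow> real" where
  "unwrap y = (if \<alpha> \<le> y then y else y + 1)"

text \<open>The point \<open>\<alpha> + x2\<close> separates the images under \<open>f_lift\<close>
  of the two sides of the hole; each branch undoes the translation on its side.\<close>

definition f_inv :: "real \<Rightarrow> real" where
  "f_inv y = (if unwrap y < \<alpha> + x2 then unwrap y - \<alpha> - h else unwrap y - \<alpha>)"

lemma f_eq_frac_lift: "t \<in> off_hole \<Longrightarrow> f t = frac (f_lift t)"
  by (auto simp: off_hole_def f_lift_def f_left f_right)

lemma f_lift_range: "t \<in> off_hole \<Longrightarrow> \<alpha> + h \<le> f_lift t \<and> f_lift t < \<alpha> + 1"
  using x by (auto simp: off_hole_def f_lift_def)

lemma f_lift_less_iff: "t \<in> off_hole \<Longrightarrow> u \<in> off_hole \<Longrightarrow> f_lift t < f_lift u \<longleftrightarrow> t < u"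
  using x by (auto simp: off_hole_def f_lift_def)

lemma unwrap_frac:
  assumes "\<alpha> \<le> y" "y < \<alpha> + 1" shows "unwrap (frac y) = y"
proof (cases "y < 1")
  case True
  then have "frac y = y" using assms \<alpha> by simp
  then show ?thesis using assms by (simp add: unwrap_def)
next
  case False
  then have "frac y = y - 1" using assms \<alpha> by (intro frac_eq_add_int[where k = 1]) auto
  then show ?thesis using assms by (simp add: unwrap_def)
qed

lemma frac_unwrap: "0 \<le> y \<Longrightarrow> y < 1 \<Longrightarrow> frac (unwrap y) = y"
  by (simp add: unwrap_def frac_1_eq)

lemma unwrap_f: "t \<in> off_hole \<Longrightarrow> unwrap (f t) = f_lift t"
  using f_lift_range[of t] x by (simp add: f_eq_frac_lift unwrap_frac)

lemma f_inv_f: "t \<in> off_hole \<Longrightarrow> f_inv (f t) = t"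
  using x by (auto simp: f_inv_def unwrap_f) (auto simp: f_lift_def off_hole_def split: if_splits)

lemma f_f_inv:
  assumes y: "0 \<le> y" "y < 1" "\<alpha> + h \<le> unwrap y"
  shows "f_inv y \<in> off_hole \<and> f (f_inv y) = y"
proof -
  have u: "unwrap y < \<alpha> + 1" using y \<alpha> by (simp add: unwrap_def)
  then have d: "f_inv y \<in> off_hole" using y x by (auto simp: f_inv_def off_hole_def)
  have "f_lift (f_inv y) = unwrap y" using x by (auto simp: f_inv_def f_lift_def)
  then show ?thesis using d f_eq_frac_lift[OF d] frac_unwrap[OF y(1,2)] by simp
qed

lemma S_sub: "S \<subseteq> off_hole" and f_S: "f ` S = S"
  using max_invariant_greatest(1)[of \<alpha> x1 x2] by (simp_all add: invariant_off_hole_def off_hole_def)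

lemma sym_invariant_sub_S: "sym_invariant_off_hole \<alpha> x1 x2 A \<Longrightarrow> A \<subseteq> S"
  by (rule max_invariant_greatest) (auto simp: sym_invariant_off_hole_def invariant_off_hole_def)

text \<open>\<open>S\<close> consists of the points whose forward and backward orbits never meet the hole, hence
  is a countable intersection of Borel sets.\<close>

primrec orbit_stage :: "nat \<Rightarrow> real set" where
  "orbit_stage 0 = off_hole"
| "orbit_stage (Suc n) = {t \<in> orbit_stage n. f t \<in> orbit_stage n \<and>
     \<alpha> + h \<le> unwrap t \<and> f_inv t \<in> orbit_stage n}"

lemma frac_borel [measurable]: "(frac :: real \<Rightarrow> real) \<in> borel_measurable borel"
  unfolding frac_def by measurable

lemma f_borel [measurable]: "f \<in> borel_measurable borel"
  unfolding hole_map_def by measurable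

lemma unwrap_borel [measurable]: "unwrap \<in> borel_measurable borel"
  unfolding unwrap_def by measurable

lemma f_inv_borel [measurable]: "f_inv \<in> borel_measurable borel"
  unfolding f_inv_def by measurable

lemma orbit_stage_borel: "orbit_stage n \<in> sets borel"
proof (induction n)
  case 0
  show ?case by (simp add: off_hole_def)
next
  case (Suc n)
  note [measurable] = Suc
  have "{t \<in> space borel. t \<in> orbit_stage n \<and> f t \<in> orbit_stage n \<and>
     \<alpha> + h \<le> unwrap t \<and> f_inv t \<in> orbit_stage n} \<in> sets borel"
    by measurable
  then show ?case by simp
qed

text \<open>Preimages off the hole are unique, so a point of all stages has the one preimage
  \<open>f_inv t\<close> in all stages. This is why the intersection is mapped onto itself and not
  merely into itself.\<close>

lemma S_eq_orbit_stages: "S = (\<Inter>n. orbit_stage n)" (is "S = ?T")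
proof
  have "S \<subseteq> orbit_stage n" for n
  proof (induction n)
    case 0
    show ?case using S_sub by simp
  next
    case (Suc n)
    show ?case
    proof
      fix t assume t: "t \<in> S"
      then obtain u where u: "u \<in> S" "t = f u" using f_S by blast
      then have "u \<in> off_hole" using S_sub by blast
      then have "\<alpha> + h \<le> unwrap t" "f_inv t = u"
        using f_lift_range[of u] unwrap_f[of u] f_inv_f[of u] u by auto
      moreover have "f t \<in> S" using t f_S by blast
      ultimately show "t \<in> orbit_stage (Suc n)" using Suc t u by auto
    qed
  qed
  then show "S \<subseteq> ?T" by blast
  have sub: "?T \<subseteq> off_hole" using orbit_stage.simps(1) by blast
  have "f t \<in> ?T" if "t \<in> ?T" for t
  proof
    fix n
    have "t \<in> orbit_stage (Suc n)" using that by blast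
    then show "f t \<in> orbit_stage n" by simp
  qed
  moreover have "t \<in> f ` ?T" if t: "t \<in> ?T" for t
  proof -
    have s: "t \<in> orbit_stage (Suc n)" for n using t by blast
    then have "f_inv t \<in> ?T" by simp
    moreover have "0 \<le> t" "t < 1" using t sub by (auto simp: off_hole_def)
    then have "f (f_inv t) = t" using f_f_inv s[of 0] by simp
    ultimately show ?thesis by (metis image_eqI)
  qed
  ultimately have "invariant_off_hole \<alpha> x1 x2 ?T"
    using sub unfolding invariant_off_hole_def off_hole_def by blast
  then show "?T \<subseteq> S" by (rule max_invariant_greatest)
qed

lemma S_section_lmeasurable: "S \<inter> {0..<t} \<in> lmeasurable"
proof (rule fmeasurableI2[of "{0..1}"])
  have "S \<in> sets borel" unfolding S_eq_orbit_stages using orbit_stage_borel by auto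
  then have "S \<in> sets lebesgue" by simp
  then show "S \<inter> {0..<t} \<in> sets lebesgue" by auto
  show "S \<inter> {0..<t} \<subseteq> {0..1}" using S_sub by (auto simp: off_hole_def)
qed simp

lemma S_eq_section: "S = S \<inter> {0..<1}"
  using S_sub by (auto simp: off_hole_def)

section \<open>Lengths of initial segments of the maximal invariant set\<close>

definition \<mu> :: "real \<Rightarrow> real" where "\<mu> t = measure lebesgue (S \<inter> {0..<t})"

text \<open>On each side of the hole \<open>f_lift\<close> is a translation, and the two images are
  separated by \<open>\<alpha> + x2\<close>.\<close>

lemma f_lift_image:
  defines "A t \<equiv> f_lift ` (S \<inter> {0..<t})"
  shows "A t \<in> lmeasurable" "measure lebesgue (A t) = \<mu> t"
proof -
  define B where "B = S \<inter> {0..<t} \<inter> {..<x1}"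
  define C where "C = S \<inter> {0..<t} \<inter> {x1..}"
  have BC: "B \<in> lmeasurable" "C \<in> lmeasurable"
    unfolding B_def C_def by (intro fmeasurable_Int_fmeasurable S_section_lmeasurable; simp)+
  have U: "S \<inter> {0..<t} = B \<union> C" "B \<inter> C = {}" by (auto simp: B_def C_def)
  have "f_lift ` B = (+) (\<alpha> + h) ` B" by (rule image_cong) (auto simp: B_def f_lift_def)
  moreover have "f_lift ` C = (+) \<alpha> ` C" by (rule image_cong) (auto simp: C_def f_lift_def)
  ultimately have A: "A t = (+) (\<alpha> + h) ` B \<union> (+) \<alpha> ` C"
    unfolding A_def U(1) image_Un by simp
  have BC': "(+) (\<alpha> + h) ` B \<in> lmeasurable" "(+) \<alpha> ` C \<in> lmeasurable"
    using BC by (simp_all only: measurable_translation)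
  then show "A t \<in> lmeasurable" unfolding A by (rule fmeasurable.Un)
  have "C \<subseteq> {x2..}" using S_sub by (auto simp: C_def off_hole_def)
  then have "(+) (\<alpha> + h) ` B \<inter> (+) \<alpha> ` C = {}" by (auto simp: B_def)
  then have "measure lebesgue (A t) = measure lebesgue B + measure lebesgue C"
    unfolding A using BC' by (simp only: measure_Un_disjoint measure_translation)
  also have "\<dots> = \<mu> t"
    unfolding \<mu>_def U(1) using BC U(2) by (simp only: measure_Un_disjoint)
  finally show "measure lebesgue (A t) = \<mu> t" .
qed

text \<open>The interval \<open>[\<alpha>, \<alpha> + 1)\<close> represents each class modulo 1 once
  and contains \<open>f_lift u\<close> for all \<open>u\<close> in \<open>S\<close>. As
  \<open>f\<close> maps \<open>S\<close> onto itself, these values form the copy of \<open>S\<close>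
  in that interval.\<close>

lemma mem_S_unwrapped:
  assumes "\<alpha> \<le> y" "y < \<alpha> + 1"
  shows "frac y \<in> S \<longleftrightarrow> y \<in> f_lift ` S"
proof
  assume "frac y \<in> S"
  then obtain u where u: "u \<in> S" "frac y = f u" using f_S by blast
  have "y = unwrap (f u)" using unwrap_frac[OF assms] u by simp
  also have "\<dots> = f_lift u" using unwrap_f S_sub u by blast
  finally show "y \<in> f_lift ` S" using u by blast
next
  assume "y \<in> f_lift ` S"
  then obtain u where u: "u \<in> S" "y = f_lift u" by blast
  then have "frac y = f u" using f_eq_frac_lift S_sub by auto
  then show "frac y \<in> S" using u f_S by auto
qed

text \<open>The set of all \<open>y \<in> [0, f_lift t)\<close> with \<open>frac y \<in> S\<close> is measured in two ways: cut at \<open>\<alpha>\<close>, and cut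
  at \<open>1\<close>.\<close>

lemma \<mu>_step:
  assumes t: "t \<in> S"
  shows "\<mu> (f t) + measure lebesgue S * (f_lift t - f t) = \<mu> t + \<mu> \<alpha>"
proof -
  define W where "W = {y. 0 \<le> y \<and> y < f_lift t \<and> frac y \<in> S}"
  have tD: "t \<in> off_hole" using t S_sub by blast
  have Ft: "\<alpha> + h \<le> f_lift t" "f_lift t < \<alpha> + 1" using f_lift_range[OF tD] by auto
  \<comment> \<open>By monotonicity of \<open>f_lift\<close>, the part of \<open>W\<close> from
    \<open>\<alpha>\<close> on is the image of the points of \<open>S\<close> below
    \<open>t\<close>.\<close>
  have img: "y \<in> f_lift ` (S \<inter> {0..<t}) \<longleftrightarrow> \<alpha> \<le> y \<and> y < f_lift t \<and> frac y \<in> S" for y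
  proof -
    have "f_lift u < f_lift t \<longleftrightarrow> u \<in> {0..<t}" if "u \<in> S" for u
      using f_lift_less_iff[of u t] that S_sub tD by (auto simp: off_hole_def)
    then have "y \<in> f_lift ` (S \<inter> {0..<t}) \<longleftrightarrow> y < f_lift t \<and> y \<in> f_lift ` S" by blast
    moreover have "\<alpha> \<le> y" if "y \<in> f_lift ` S" using that f_lift_range S_sub x by fastforce
    ultimately show ?thesis using mem_S_unwrapped[of y] Ft by fastforce
  qed
  have W1: "W = (S \<inter> {0..<\<alpha>}) \<union> f_lift ` (S \<inter> {0..<t})"
  proof (rule set_eqI)
    fix y
    show "y \<in> W \<longleftrightarrow> y \<in> (S \<inter> {0..<\<alpha>}) \<union> f_lift ` (S \<inter> {0..<t})"
      unfolding Un_iff img using \<alpha> x Ft by (cases "y < \<alpha>") (auto simp: W_def)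
  qed
  have "y \<notin> f_lift ` (S \<inter> {0..<t})" if "y \<in> S \<inter> {0..<\<alpha>}" for y
    using that by (simp add: img del: image_iff)
  then have "(S \<inter> {0..<\<alpha>}) \<inter> f_lift ` (S \<inter> {0..<t}) = {}" by blast
  then have m1: "measure lebesgue W = \<mu> \<alpha> + \<mu> t"
    unfolding W1 using f_lift_image S_section_lmeasurable by (simp add: measure_Un_disjoint \<mu>_def)
  have f_coh: "f t = frac (f_lift t)" using f_eq_frac_lift tD by simp
  \<comment> \<open>The difference \<open>f_lift t - f t\<close> is 0 or 1, the number of full turns
    in \<open>[0, f_lift t)\<close>; a full turn contributes the measure of \<open>S\<close> to
    \<open>W\<close>.\<close>
  show ?thesis
  proof (cases "f_lift t < 1")
    case True
    then have "f t = f_lift t" using f_coh Ft \<alpha> x by simp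
    moreover have "W = S \<inter> {0..<f_lift t}" using True by (auto simp: W_def)
    ultimately show ?thesis using m1 by (simp add: \<mu>_def)
  next
    case False
    then have ft': "f t = f_lift t - 1"
      unfolding f_coh using Ft \<alpha> by (intro frac_eq_add_int[where k = 1]) auto
    have fr: "frac y = y - 1" if "1 \<le> y" "y < f_lift t" for y
      using that Ft \<alpha> by (intro frac_eq_add_int[where k = 1]) auto
    have W2: "W = (S \<inter> {0..<1}) \<union> (+) 1 ` (S \<inter> {0..<f t})"
    proof (rule set_eqI)
      fix y
      have "y \<in> (+) 1 ` (S \<inter> {0..<f t}) \<longleftrightarrow> y - 1 \<in> S \<inter> {0..<f t}"
        by (auto simp: image_iff intro!: bexI[of _ "y - 1"])
      then show "y \<in> W \<longleftrightarrow> y \<in> (S \<inter> {0..<1}) \<union> (+) 1 ` (S \<inter> {0..<f t})"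
        unfolding Un_iff using False fr[of y] by (cases "y < 1") (auto simp: W_def ft')
    qed
    have "(S \<inter> {0..<1}) \<inter> (+) 1 ` (S \<inter> {0..<f t}) = {}" by auto
    then have "measure lebesgue W = measure lebesgue (S \<inter> {0..<1}) + \<mu> (f t)"
      unfolding W2 \<mu>_def
      by (subst measure_Un_disjoint)
        (simp_all only: S_section_lmeasurable measurable_translation measure_translation)
    then show ?thesis using m1 ft' S_eq_section by simp
  qed
qed

text \<open>Sum \<open>\<mu>_step\<close> over \<open>C\<close>. As \<open>f\<close> permutes
  \<open>C\<close>, the sums of \<open>\<mu> (f t)\<close> and \<open>\<mu> t\<close> cancel, and so
  do those of \<open>f t\<close> and \<open>t\<close>. What remains is \<open>\<alpha>\<close> for
  each point and a further \<open>h\<close> for each point left of the hole.\<close>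

lemma rotation_number:
  assumes C: "C \<subseteq> S" "finite C" "C \<noteq> {}" "f ` C = C" and S: "measure lebesgue S > 0"
  shows "\<mu> \<alpha> / measure lebesgue S = \<alpha> + h * real (card (C \<inter> {..<x1})) / real (card C)"
proof -
  have inj: "inj_on f C" using C by (metis eq_card_imp_inj_on)
  have re: "(\<Sum>t\<in>C. g (f t)) = (\<Sum>t\<in>C. g t)" for g :: "real \<Rightarrow> real"
    using sum.reindex[OF inj, of g] C(4) by (simp add: o_def)
  define s where "s = measure lebesgue S"
  have "(\<Sum>t\<in>C. \<mu> (f t) + s * (f_lift t - f t)) = (\<Sum>t\<in>C. \<mu> t + \<mu> \<alpha>)"
    using \<mu>_step C(1) by (intro sum.cong) (auto simp: s_def)
  then have "s * ((\<Sum>t\<in>C. f_lift t) - (\<Sum>t\<in>C. f t)) = real (card C) * \<mu> \<alpha>"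
    by (simp add: sum.distrib sum_subtractf re flip: sum_distrib_left)
  moreover have "(\<Sum>t\<in>C. f_lift t) - (\<Sum>t\<in>C. f t)
      = real (card C) * \<alpha> + h * real (card (C \<inter> {..<x1}))"
  proof -
    have "(\<Sum>t\<in>C. f_lift t) = (\<Sum>t\<in>C. t + \<alpha> + (if t \<in> {..<x1} then h else 0))"
      by (intro sum.cong) (auto simp: f_lift_def)
    also have "\<dots> = (\<Sum>t\<in>C. t) + real (card C) * \<alpha> + (\<Sum>t\<in>C \<inter> {..<x1}. h)"
      unfolding sum.inter_restrict[OF C(2)] by (simp only: sum.distrib sum_constant)
    finally show ?thesis using re[of "\<lambda>t. t"] by (simp add: mult.commute)
  qed
  ultimately have "s * (real (card C) * \<alpha> + h * real (card (C \<inter> {..<x1}))) = real (card C) * \<mu> \<alpha>"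
    by simp
  moreover have "real (card C) > 0" using C by (simp add: card_gt_0_iff)
  ultimately show ?thesis using S unfolding s_def[symmetric] by (simp add: field_simps)
qed

text \<open>The left endpoints of the blocks form the finite invariant set for
  \<open>rotation_number\<close>; a single block inside \<open>S\<close> makes the measure of
  \<open>S\<close> positive.\<close>

lemma Y_map_blocks:
  assumes "N < M" "P > 0" "a < b" "sym_invariant_off_hole \<alpha> x1 x2 (blocks M P a b)"
    and f: "\<And>k. k < M \<Longrightarrow> f (a + real k * P) = a + real ((k + N) mod M) * P"
  shows "Y_map \<alpha> x1 x2 \<alpha> = frac (\<alpha> + h * real (card {k. k < M \<and> a + real k * P < x1}) / real M)"
proof -
  have JS: "blocks M P a b \<subseteq> S" using assms(4) by (rule sym_invariant_sub_S)
  define g where "g k = a + real k * P" for k :: nat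
  have g: "inj g" using assms(2) by (auto simp: inj_def g_def)
  define C where "C = g ` {..<M}"
  have C: "C = {t. \<exists>k<M. \<exists>r. r = a \<and> t = r + real k * P}" by (auto simp: C_def g_def)
  have "C \<subseteq> blocks M P a b" using assms(3) by (force simp: C mem_blocks)
  then have "C \<subseteq> S" using JS by blast
  moreover have "finite C" "C \<noteq> {}" using assms(1) by (auto simp: C_def)
  moreover have "f ` C = C" unfolding C by (rule image_blocks_shift[OF assms(1)]) (use f in blast)
  moreover have "measure lebesgue S > 0"
  proof -
    have "{a..<b} \<subseteq> S"
    proof
      fix t assume "t \<in> {a..<b}"
      then have "t \<in> blocks M P a b"
        unfolding mem_blocks using assms(1) by (intro exI[of _ 0]) auto
      then show "t \<in> S" using JS by blast
    qed
    then have "measure lebesgue {a..<b} \<le> measure lebesgue S"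
      using S_section_lmeasurable[of 1] S_eq_section by (intro measure_mono_fmeasurable) auto
    then show ?thesis using assms(3) by simp
  qed
  ultimately have "\<mu> \<alpha> / measure lebesgue S = \<alpha> + h * real (card (C \<inter> {..<x1})) / real (card C)"
    by (rule rotation_number)
  moreover have "card C = M" unfolding C_def using g by (simp add: card_image inj_on_subset)
  moreover have "C \<inter> {..<x1} = g ` {k. k < M \<and> a + real k * P < x1}"
    by (auto simp: C_def g_def)
  then have "card (C \<inter> {..<x1}) = card {k. k < M \<and> a + real k * P < x1}"
    using g by (simp add: card_image inj_on_subset)
  ultimately show ?thesis by (simp add: Y_map_def \<mu>_def)
qed

subsection \<open>The three cases\<close>

lemma sym_hole_max: "sym_hole \<alpha> x1 x2 (sym_max_invariant \<alpha> x1 x2)"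
  by unfold_locales (rule sym_max_invariant_greatest)

lemma case_i_result:
  assumes NM: "N < M" "coprime N M" and c: "case_i N M \<alpha> x1 x2"
  shows "sym_max_invariant \<alpha> x1 x2 = (\<Union>k<M. (+) (real k / real M) ` {x2 ..< 1 / real M - x2})"
    and "sym_max_invariant \<alpha> x1 x2 \<noteq> {}"
    and "Y_map \<alpha> x1 x2 \<alpha> = real N / real M"
proof -
  interpret sym_hole \<alpha> x1 x2 "sym_max_invariant \<alpha> x1 x2" by (rule sym_hole_max)
  define P where "P = 1 / real M"
  have P: "P > 0" "\<alpha> = real N * P" "real M * P = 1" using NM c by (simp_all add: P_def case_i_def)
  note J = case_i_blocks[OF NM(1) c, folded P_def]
  have JE: "blocks M P x2 (P - x2) \<subseteq> sym_max_invariant \<alpha> x1 x2"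
    using J(1) by (rule sym_max_invariant_greatest)
  have "x2 \<in> blocks M P x2 (P - x2)"
    unfolding mem_blocks using NM(1) J(2) by (intro exI[of _ 0]) auto
  then have x2E: "x2 \<in> sym_max_invariant \<alpha> x1 x2" using JE by blast
  then show "sym_max_invariant \<alpha> x1 x2 \<noteq> {}" by blast
  \<comment> \<open>A point left of the hole would, together with \<open>x2\<close>, put
    \<open>E\<close> in the mixed situation and force \<open>x2 + \<alpha> \<ge> 1\<close>; but
    \<open>\<alpha> \<le> 1 - P\<close> and \<open>x2 < P - x2\<close>.\<close>
  have r: "x2 \<le> t" if t: "t \<in> sym_max_invariant \<alpha> x1 x2" for t
  proof (rule ccontr)
    assume "\<not> x2 \<le> t"
    then have "t < x1" using E_hole[OF t] by simp
    then have "1 \<le> x2 + \<alpha>" using mixed_right(1)[OF x2E _ t] by simp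
    moreover have "\<alpha> \<le> 1 - P" using mult_le_last[OF NM(1), of P] P by simp
    ultimately show False using J(2) x by linarith
  qed
  have "sym_max_invariant \<alpha> x1 x2 \<subseteq> blocks M P x2 (P - x2)"
  proof
    fix t assume "t \<in> sym_max_invariant \<alpha> x1 x2"
    then obtain q k where "k < M" "t = real k / real M + q" "x2 \<le> q" "q < 1 / real M - x2"
      using right_blocks[OF r NM(2,1)] c unfolding case_i_def by metis
    then show "t \<in> blocks M P x2 (P - x2)"
      unfolding mem_blocks by (intro exI[of _ k] conjI exI[of _ q]) (auto simp: P_def)
  qed
  with JE have "sym_max_invariant \<alpha> x1 x2 = blocks M P x2 (P - x2)" by blast
  then show "sym_max_invariant \<alpha> x1 x2 = (\<Union>k<M. (+) (real k / real M) ` {x2 ..< 1 / real M - x2})"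
    by (simp add: blocks_def P_def)
  have "Y_map \<alpha> x1 x2 \<alpha> = frac (\<alpha> + h * real (card {k. k < M \<and> x2 + real k * P < x1}) / real M)"
    using J P by (intro Y_map_blocks[OF NM(1) _ J(2,1)]) auto
  moreover have "\<not> x2 + real k * P < x1" for k
  proof -
    have "0 \<le> real k * P" using P by simp
    then show ?thesis using x by linarith
  qed
  ultimately show "Y_map \<alpha> x1 x2 \<alpha> = real N / real M" using \<alpha> c by (simp add: case_i_def)
qed

lemma case_ii_result:
  assumes NM: "N < M" "coprime N M" and c: "case_ii N M \<alpha> x1 x2"
  shows "sym_max_invariant \<alpha> x1 x2 =
      (\<Union>k<M. (+) (real k / real M) ` {1 - x1 ..< x1 - (real M - 1) / real M})"
    and "sym_max_invariant \<alpha> x1 x2 \<noteq> {}"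
    and "Y_map \<alpha> x1 x2 \<alpha> = real N / real M"
proof -
  interpret sym_hole \<alpha> x1 x2 "sym_max_invariant \<alpha> x1 x2" by (rule sym_hole_max)
  define P where "P = 1 / real M"
  have P: "P > 0" "real M * P = 1" "real N * P = real N / real M"
    using NM by (simp_all add: P_def)
  obtain l :: int where l: "\<alpha> + h = real N * P + of_int l"
    using case_ii_shift[OF c] P by metis
  have N: "0 \<le> real N * P" "real N * P \<le> 1 - P" using mult_le_last[OF NM(1), of P] P by auto
  note J = case_ii_blocks[OF NM(1) c, folded P_def]
  let ?J = "blocks M P (1 - x1) (P - (1 - x1))"
  have JE: "?J \<subseteq> sym_max_invariant \<alpha> x1 x2"
    using J(1) by (rule sym_max_invariant_greatest)
  \<comment> \<open>The left endpoint of the last block, hence a point of \<open>E\<close> with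
    \<open>u \<ge> 1 - P\<close>.\<close>
  define u where "u = 1 - x1 + real (M - 1) * P"
  have u': "u = 1 - x1 + 1 - P" using NM(1) P by (simp add: u_def of_nat_diff left_diff_distrib)
  have "u \<in> ?J"
    unfolding mem_blocks using NM(1) J(2)
    by (intro exI[of _ "M - 1"] conjI exI[of _ "1 - x1"]) (auto simp: u_def)
  then have uE: "u \<in> sym_max_invariant \<alpha> x1 x2" using JE by blast
  then show "sym_max_invariant \<alpha> x1 x2 \<noteq> {}" by blast
  have ux: "u < x1" using J(2) u' by simp
  \<comment> \<open>A point right of the hole would force \<open>u + \<alpha> + h < 1\<close>, hence
    \<open>0 < \<alpha> + h < P\<close>. As \<open>\<alpha> + h\<close> is \<open>real N * P\<close>
    plus an integer and \<open>real N * P \<le> 1 - P\<close>, that integer is 0, and no multiple of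
    \<open>P\<close> lies strictly between 0 and \<open>P\<close>.\<close>
  have r: "t < x1" if t: "t \<in> sym_max_invariant \<alpha> x1 x2" for t
  proof (rule ccontr)
    assume "\<not> t < x1"
    then have "x2 \<le> t" using E_hole[OF t] by simp
    then have lt: "u + \<alpha> + h < 1" using mixed_left(1)[OF uE ux t] by simp
    then have "\<alpha> + h < P" using u' x by linarith
    have "0 < \<alpha> + h" using \<alpha> x by linarith
    then have "0 < real N * P + of_int l" by (simp only: l)
    then have "-1 < (of_int l :: real)" using N P by linarith
    then have "0 \<le> l" by linarith
    have "of_int l < (1 :: real)" using l lt N E_range(1)[OF uE] by linarith
    then have "l = 0" using \<open>0 \<le> l\<close> by linarith
    then have "0 < real N * P" "real N * P < P" using l \<open>0 < \<alpha> + h\<close> \<open>\<alpha> + h < P\<close> by simp_all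
    then show False using P by (cases N) (auto simp: algebra_simps mult_less_0_iff)
  qed
  have fr: "frac (\<alpha> + h) = real N / real M"
    unfolding l using N P by (intro frac_eq_add_int[where k = l]) auto
  have e: "P - (1 - x1) = x1 - (real M - 1) / real M"
    using NM(1) by (simp add: P_def field_simps)
  have "sym_max_invariant \<alpha> x1 x2 \<subseteq> ?J"
  proof
    fix t assume "t \<in> sym_max_invariant \<alpha> x1 x2"
    then obtain q k where "k < M" "t = real k / real M + q" "1 - x1 \<le> q"
        "q < x1 - (real M - 1) / real M"
      using left_blocks[OF r NM(2,1) fr] by metis
    then show "t \<in> ?J"
      unfolding mem_blocks e by (intro exI[of _ k] conjI exI[of _ q]) (auto simp: P_def)
  qed
  with JE have "sym_max_invariant \<alpha> x1 x2 = ?J" by blast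
  then show "sym_max_invariant \<alpha> x1 x2 =
      (\<Union>k<M. (+) (real k / real M) ` {1 - x1 ..< x1 - (real M - 1) / real M})"
    unfolding e by (simp add: blocks_def P_def)
  have "Y_map \<alpha> x1 x2 \<alpha> =
      frac (\<alpha> + h * real (card {k. k < M \<and> 1 - x1 + real k * P < x1}) / real M)"
    using J by (intro Y_map_blocks[OF NM(1) P(1) J(2,1)]) auto
  moreover have "{k. k < M \<and> 1 - x1 + real k * P < x1} = {..<M}"
    using J(4)[OF order_refl J(2)] by blast
  ultimately show "Y_map \<alpha> x1 x2 \<alpha> = real N / real M" using NM(1) fr by simp
qed

lemma case_iii_result:
  assumes NM: "N < M" "coprime N M" and c: "case_iii N M \<Delta> \<delta> \<alpha> x1 x2"
  shows "sym_max_invariant \<alpha> x1 x2 =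
      (\<Union>k<M. (+) (real k / real M * (1 + \<Delta>)) `
         {\<bar>\<delta>\<bar> ..< (1 - (real M - 1) * \<Delta>) / real M - \<bar>\<delta>\<bar>})"
    and "sym_max_invariant \<alpha> x1 x2 \<noteq> {}"
    and "Y_map \<alpha> x1 x2 \<alpha> = real N / real M"
proof -
  interpret sym_hole \<alpha> x1 x2 "sym_max_invariant \<alpha> x1 x2" by (rule sym_hole_max)
  define P where "P = (1 + h) / real M"
  note P = case_iii_parameters[OF NM(1) c, folded P_def]
  note J = case_iii_blocks[OF NM(1) c, folded P_def]
  have ab: "\<bar>\<delta>\<bar> < P - h - \<bar>\<delta>\<bar>" using P(6) by linarith
  let ?J = "blocks M P \<bar>\<delta>\<bar> (P - h - \<bar>\<delta>\<bar>)"
  have JE: "?J \<subseteq> sym_max_invariant \<alpha> x1 x2"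
    using J(1) by (rule sym_max_invariant_greatest)
  have JM: "\<bar>\<delta>\<bar> + real k * P \<in> sym_max_invariant \<alpha> x1 x2" if "k < M" for k
  proof -
    have "\<bar>\<delta>\<bar> + real k * P \<in> ?J"
      unfolding mem_blocks using that ab by (intro exI[of _ k] conjI exI[of _ "\<bar>\<delta>\<bar>"]) auto
    then show ?thesis using JE by blast
  qed
  have N0: "0 < N"
  proof (rule ccontr)
    assume "\<not> 0 < N"
    then have "M = 1" using NM by simp
    then show False using c by (simp add: case_iii_def)
  qed
  \<comment> \<open>The first block lies left of the hole and the last, by \<open>0 < N\<close>,
    right of it, so the mixed analysis applies.\<close>
  define u where "u = \<bar>\<delta>\<bar> + real 0 * P"
  define v where "v = \<bar>\<delta>\<bar> + real (M - 1) * P"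
  have u: "u \<in> sym_max_invariant \<alpha> x1 x2" "u < x1"
    unfolding u_def using JM[of 0] J(3)[OF _ ab, of 0] NM(1) by auto
  have M1: "M - 1 < M" "\<not> M - 1 < M - N" using NM(1) N0 by auto
  have v: "v \<in> sym_max_invariant \<alpha> x1 x2" unfolding v_def using JM M1(1) .
  have "\<not> v < x1" unfolding v_def using J(3)[OF _ ab M1(1)] M1(2) by simp
  then have v': "x2 \<le> v" using E_hole[OF v] by simp
  then show "sym_max_invariant \<alpha> x1 x2 \<noteq> {}" using v by blast
  have fr: "(\<alpha> + h) / (1 + h) = real N / real M"
    unfolding P(3,4)[symmetric] using P(2) by simp
  \<comment> \<open>Identifies the displacement that \<open>mixed_blocks\<close> computes from the
    spacing with the given parameter \<open>\<delta>\<close>.\<close>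
  have \<delta>: "x2 - real (M - N) * P = \<delta>"
    using NM(1) P by (simp add: of_nat_diff left_diff_distrib)
  have "sym_max_invariant \<alpha> x1 x2 \<subseteq> ?J"
  proof
    fix t assume t: "t \<in> sym_max_invariant \<alpha> x1 x2"
    obtain q k where "k < M" "t = q + real k * P" "\<bar>\<delta>\<bar> \<le> q" "q < P - h - \<bar>\<delta>\<bar>"
      using mixed_blocks[OF u v v' NM(2,1) fr t, folded P_def, unfolded \<delta>] by metis
    then show "t \<in> ?J" unfolding mem_blocks by blast
  qed
  with JE have eq: "sym_max_invariant \<alpha> x1 x2 = ?J" by blast
  have "P - h = (1 - (real M - 1) * \<Delta>) / real M" "real k * P = real k / real M * (1 + \<Delta>)" for k
    using NM(1) unfolding P(1) P_def by (simp_all add: field_simps)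
  then show "sym_max_invariant \<alpha> x1 x2 =
      (\<Union>k<M. (+) (real k / real M * (1 + \<Delta>)) `
         {\<bar>\<delta>\<bar> ..< (1 - (real M - 1) * \<Delta>) / real M - \<bar>\<delta>\<bar>})"
    unfolding eq blocks_def by (simp only:)
  have "Y_map \<alpha> x1 x2 \<alpha> =
      frac (\<alpha> + h * real (card {k. k < M \<and> \<bar>\<delta>\<bar> + real k * P < x1}) / real M)"
    using J(2)[OF _ ab] by (intro Y_map_blocks[OF NM(1) P(2) ab J(1)]) auto
  moreover have "{k. k < M \<and> \<bar>\<delta>\<bar> + real k * P < x1} = {..<M - N}"
    using J(3)[OF _ ab] by auto
  moreover have "\<alpha> + h * real (M - N) / real M = real N / real M"
  proof -
    have "\<alpha> = real N * (1 + h) / real M - h" using P(4) by (simp add: P_def)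
    then show ?thesis using NM(1) by (simp add: of_nat_diff field_simps)
  qed
  moreover have "real N / real M < 1" using NM(1) by simp
  ultimately show "Y_map \<alpha> x1 x2 \<alpha> = real N / real M" by simp
qed

text \<open>The angle divided by the length of the circle supplies \<open>N / M\<close>. The offset
  \<open>q\<close> of a single point of \<open>E\<close> lies in an interval that is therefore
  nonempty, which yields the strict inequalities of the three cases.\<close>

lemma nonempty_imp_case:
  assumes "sym_max_invariant \<alpha> x1 x2 \<noteq> {}"
  obtains N M where "N < M" "coprime N M"
    "case_i N M \<alpha> x1 x2 \<or> case_ii N M \<alpha> x1 x2 \<or> (\<exists>\<Delta> \<delta>. case_iii N M \<Delta> \<delta> \<alpha> x1 x2)"
proof -
  interpret sym_hole \<alpha> x1 x2 "sym_max_invariant \<alpha> x1 x2" by (rule sym_hole_max)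
  obtain t where t: "t \<in> sym_max_invariant \<alpha> x1 x2" using assms by blast
  consider
    (right) "\<And>t. t \<in> sym_max_invariant \<alpha> x1 x2 \<Longrightarrow> x2 \<le> t"
  | (left) "\<And>t. t \<in> sym_max_invariant \<alpha> x1 x2 \<Longrightarrow> t < x1"
  | (mixed) u v where "u \<in> sym_max_invariant \<alpha> x1 x2" "u < x1"
      "v \<in> sym_max_invariant \<alpha> x1 x2" "x2 \<le> v"
    using E_hole by blast
  then show ?thesis
  proof cases
    case right
    obtain N M where NM: "coprime N M" "N < M" "\<alpha> = real N / real M"
      using unit_fraction_coprime[OF right_rational[OF assms right] \<alpha>] .
    obtain q where "x2 \<le> q" "q < 1 / real M - x2"
      using right_blocks[OF right NM t] by metis
    then have "2 * x2 < 1 / real M" by linarith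
    then have "x2 < 1 / (2 * real M)" using NM(2) by (simp add: field_simps)
    then show ?thesis using that NM by (simp add: case_i_def)
  next
    case left
    obtain N M where NM: "coprime N M" "N < M" "frac (\<alpha> + h) = real N / real M"
      using unit_fraction_coprime[OF left_rational[OF assms left] frac_ge_0 frac_lt_1] .
    have "(real M - 1) / real M = 1 - 1 / real M" using NM(2) by (simp add: field_simps)
    then obtain q where "1 - x1 \<le> q" "q < x1 - (1 - 1 / real M)"
      using left_blocks[OF left NM t] by metis
    then have "1 - x1 < x1 - (1 - 1 / real M)" by (rule le_less_trans)
    then have "x1 > 1 - 1 / (2 * real M)" using NM(2) by (simp add: field_simps)
    moreover have "frac (real N / real M - h) = \<alpha>"
      unfolding NM(3)[symmetric] using \<alpha>
      by (intro frac_eq_add_int[where k = "- \<lfloor>\<alpha> + h\<rfloor>"]) (auto simp: frac_def)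
    ultimately show ?thesis using that NM by (simp add: case_ii_def)
  next
    case mixed
    have "0 \<le> (\<alpha> + h) / (1 + h)" "(\<alpha> + h) / (1 + h) < 1" using \<alpha> x by simp_all
    then obtain N M where NM: "coprime N M" "N < M" "(\<alpha> + h) / (1 + h) = real N / real M"
      using unit_fraction_coprime[OF mixed_rational[OF mixed]] by metis
    define P where "P = (1 + h) / real M"
    define \<delta> where "\<delta> = x2 - real (M - N) * P"
    obtain q where q: "0 < N" "\<bar>\<delta>\<bar> \<le> q" "q < P - h - \<bar>\<delta>\<bar>"
      using mixed_blocks[OF mixed NM t, folded P_def, folded \<delta>_def] by metis
    have M: "real M > 0" "M > 1" using NM(2) q(1) by simp_all
    have NP: "real M * P = 1 + h" "real N * P = \<alpha> + h"
      using M x NM(3) by (simp_all add: P_def field_simps)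
    have MN: "real (M - N) = real M - real N" using NM(2) by (simp add: of_nat_diff)
    have \<delta>: "2 * \<bar>\<delta>\<bar> < P - h" using q by linarith
    then have "h < P" by linarith
    have "\<bar>\<delta>\<bar> < 1 / (2 * real M) - (real M - 1) / (2 * real M) * h"
      using \<delta> M by (simp add: P_def field_simps)
    moreover have "h < 1 / (real M - 1)"
      using \<open>h < P\<close> M by (simp add: P_def field_simps)
    moreover have "x2 = (real M - real N) / real M * (1 + h) + \<delta>"
      unfolding \<delta>_def MN P_def by simp
    moreover have "(real M - real N) / real M * (1 + h) - h
        = (real M - real N) / real M - real N / real M * h"
      using M by (simp add: field_simps)
    moreover from calculation
    have "x1 = (real M - real N) / real M - real N / real M * h + \<delta>"
      by argo
    moreover have "\<alpha> = real N / real M - (real M - real N) / real M * h"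
    proof -
      have "\<alpha> = real N * (1 + h) / real M - h" using NP(2) by (simp add: P_def)
      then show ?thesis using M by (simp add: field_simps)
    qed
    moreover have "0 < h" using x by simp
    ultimately have "case_iii N M h \<delta> \<alpha> x1 x2" using M(2) unfolding case_iii_def by blast
    then show ?thesis using that NM by blast
  qed
qed

end

theorem proposition1p5:
  fixes \<alpha> x1 x2 :: real
  assumes "0 \<le> \<alpha>" and "\<alpha> < 1"
    and "0 \<le> x1" and "x1 < x2" and "x2 \<le> 1"
  shows
    "(sym_max_invariant \<alpha> x1 x2 \<noteq> {} \<longrightarrow>
        Y_map \<alpha> x1 x2 \<alpha> \<in> \<rat> \<and>
        (\<forall>N M. simple_fraction (Y_map \<alpha> x1 x2 \<alpha>) N M \<longrightarrow>
           case_i N M \<alpha> x1 x2 \<or> case_ii N M \<alpha> x1 x2 \<or>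
           (\<exists>\<Delta> \<delta>. case_iii N M \<Delta> \<delta> \<alpha> x1 x2))) \<and>
     (\<forall>N M. N < M \<and> simple_fraction (real N / real M) N M \<longrightarrow>
        (case_i N M \<alpha> x1 x2 \<or> case_ii N M \<alpha> x1 x2 \<or>
           (\<exists>\<Delta> \<delta>. case_iii N M \<Delta> \<delta> \<alpha> x1 x2) \<longrightarrow>
           sym_max_invariant \<alpha> x1 x2 \<noteq> {} \<and> Y_map \<alpha> x1 x2 \<alpha> = real N / real M) \<and>
        (case_i N M \<alpha> x1 x2 \<longrightarrow>
           sym_max_invariant \<alpha> x1 x2 =
             (\<Union>k<M. (+) (real k / real M) ` {x2 ..< 1 / real M - x2})) \<and>
        (case_ii N M \<alpha> x1 x2 \<longrightarrow>
           sym_max_invariant \<alpha> x1 x2 =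
             (\<Union>k<M. (+) (real k / real M) ` {1 - x1 ..< x1 - (real M - 1) / real M})) \<and>
        (\<forall>\<Delta> \<delta>. case_iii N M \<Delta> \<delta> \<alpha> x1 x2 \<longrightarrow>
           sym_max_invariant \<alpha> x1 x2 =
             (\<Union>k<M. (+) (real k / real M * (1 + \<Delta>)) `
                {\<bar>\<delta>\<bar> ..< (1 - (real M - 1) * \<Delta>) / real M - \<bar>\<delta>\<bar>})))"
proof -
  interpret hole \<alpha> x1 x2 using assms by unfold_locales
  have Y: "Y_map \<alpha> x1 x2 \<alpha> = real N / real M"
    if "N < M" "coprime N M"
      "case_i N M \<alpha> x1 x2 \<or> case_ii N M \<alpha> x1 x2 \<or> (\<exists>\<Delta> \<delta>. case_iii N M \<Delta> \<delta> \<alpha> x1 x2)" for N M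
    using that case_i_result(3) case_ii_result(3) case_iii_result(3) by blast
  have nonempty: "sym_max_invariant \<alpha> x1 x2 \<noteq> {}"
    if "N < M" "coprime N M"
      "case_i N M \<alpha> x1 x2 \<or> case_ii N M \<alpha> x1 x2 \<or> (\<exists>\<Delta> \<delta>. case_iii N M \<Delta> \<delta> \<alpha> x1 x2)" for N M
    using that case_i_result(2) case_ii_result(2) case_iii_result(2) by blast
  show ?thesis
  proof (intro conjI impI allI; (elim conjE)?)
    assume "sym_max_invariant \<alpha> x1 x2 \<noteq> {}"
    then obtain N M where NM: "N < M" "coprime N M"
      "case_i N M \<alpha> x1 x2 \<or> case_ii N M \<alpha> x1 x2 \<or> (\<exists>\<Delta> \<delta>. case_iii N M \<Delta> \<delta> \<alpha> x1 x2)"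
      using nonempty_imp_case by blast
    \<comment> \<open>By the converse direction, the fraction found from \<open>E\<close> is the
      value of \<open>Y_map\<close> at \<open>\<alpha>\<close>; uniqueness of lowest terms then
      identifies it with any given simple fraction.\<close>
    note Y = Y[OF this]
    show "Y_map \<alpha> x1 x2 \<alpha> \<in> \<rat>" unfolding Y by simp
    fix N' M' assume "simple_fraction (Y_map \<alpha> x1 x2 \<alpha>) N' M'"
    then have "N' = N \<and> M' = M" unfolding Y using simple_fraction_unique NM by blast
    then show "case_i N' M' \<alpha> x1 x2 \<or> case_ii N' M' \<alpha> x1 x2 \<or>
        (\<exists>\<Delta> \<delta>. case_iii N' M' \<Delta> \<delta> \<alpha> x1 x2)"
      using NM by simp
  qed (simp_all add: simple_fraction_iff Y nonempty case_i_result(1) case_ii_result(1)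
      case_iii_result(1))
qed

end
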